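(* Let $(X,\mu,\mathcal{E},\mathcal{F})$ be a symmetric Dirichlet space with conservative semigroup $\{P_t\}_{t\ge 0}$ and let $1<p\le2$. Let $L$ be the infinitesimal generator of $\mathcal{E}$ and let $\mathcal{L}_p$ be the domain of $L$ in $L^p(X,\mu)$. Then $\mathcal{L}_p\subset\mathbf{B}^{p,1/2}(X)$, and there is a constant $C_p>0$ such that for every $f\in\mathcal{L}_p$, \[ \|f\|_{p,1/2}^2\le C_p\,\|Lf\|_{L^p(X,\mu)}\,\|f\|_{L^p(X,\mu)} . \]
   Context: $X$ is a topological space equipped with a Radon measure $\mu$; $\mathcal{E}$ is a symmetric Dirichlet form (closed Markovian symmetric bilinear form) on $L^2(X,\mu)$ with domain $\mathcal{F}$. $\{P_t\}_{t\ge0}$ is the associated Markovian semigroup, extended to a positive contraction semigroup on every $L^p(X,\mu)$, $1\le p\le\infty$, strongly continuous for $1\le p<\infty$. Standing assumption: $P_t$ is conservative, i.e. $P_t1=1$. $\mathcal{L}_p$ is the domain of the generator (again denoted $L$) of the strongly continuous semigroup $P_t:L^p(X,\mu)\to L^p(X,\mu)$. For $p\ge1$, $\alpha\ge0$ and $f\in L^p(X,\mu)$ define \[ \|f\|_{p,\alpha}=\sup_{t>0}t^{-\alpha}\left(\int_X P_t(|f-f(y)|^p)(y)\,d\mu(y)\right)^{1/p}, \] where the inner expression is understood through the heat kernel measures of $P_t$; if $P_t$ has a heat kernel $p_t(x,y)$, the integral equals $\int_X\int_X|f(x)-f(y)|^pp_t(x,y)\,d\mu(x)\,d\mu(y)$.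 The Besov space is $\mathbf{B}^{p,\alpha}(X)=\{f\in L^p(X,\mu):\|f\|_{p,\alpha}<\infty\}$. *)

theory Defs
  imports "HOL-Probability.Probability"
begin

section \<open>Lebesgue spaces\<close>

text \<open>
  Elements of \<open>L\<^sup>p\<close> are represented by Borel functions; every notion below that depends on
  a function is required to be (or is by construction) compatible with almost everywhere equality.
\<close>

definition Lp :: "'a measure \<Rightarrow> real \<Rightarrow> ('a \<Rightarrow> real) set" where
  "Lp M p = {f \<in> borel_measurable M. integrable M (\<lambda>x. \<bar>f x\<bar> powr p)}"

definition Lp_norm :: "'a measure \<Rightarrow> real \<Rightarrow> ('a \<Rightarrow> real) \<Rightarrow> real" where
  "Lp_norm M p f = (\<integral>x. \<bar>f x\<bar> powr p \<partial>M) powr (1 / p)"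

definition Linf :: "'a measure \<Rightarrow> ('a \<Rightarrow> real) set" where
  "Linf M = {f \<in> borel_measurable M. \<exists>c. AE x in M. \<bar>f x\<bar> \<le> c}"

definition Linf_norm :: "'a measure \<Rightarrow> ('a \<Rightarrow> real) \<Rightarrow> real" where
  "Linf_norm M f = Inf {c. 0 \<le> c \<and> (AE x in M. \<bar>f x\<bar> \<le> c)}"


section \<open>Radon measures\<close>

text \<open>
  The underlying space is not assumed to be Hausdorff, so compact sets need not be Borel sets.
\<close>

definition radon_measure :: "'a::topological_space measure \<Rightarrow> bool" where
  "radon_measure M \<longleftrightarrow>
     sets M = sets borel \<and>
     (\<forall>x. \<exists>U. open U \<and> x \<in> U \<and> emeasure M U < \<infinity>) \<and>
     (\<forall>A\<in>sets M. emeasure M A =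
        (SUP K\<in>{K. compact K \<and> K \<in> sets M \<and> K \<subseteq> A}. emeasure M K))"


section \<open>Symmetric Dirichlet forms\<close>

definition form1 ::
  "'a measure \<Rightarrow> (('a \<Rightarrow> real) \<Rightarrow> ('a \<Rightarrow> real) \<Rightarrow> real) \<Rightarrow> ('a \<Rightarrow> real) \<Rightarrow> ('a \<Rightarrow> real) \<Rightarrow> real" where
  "form1 M E f g = E f g + (\<integral>x. f x * g x \<partial>M)"

locale dirichlet_form =
  fixes M :: "'a measure"
    and F :: "('a \<Rightarrow> real) set"
    and E :: "('a \<Rightarrow> real) \<Rightarrow> ('a \<Rightarrow> real) \<Rightarrow> real"
  assumes domain_L2: "F \<subseteq> Lp M 2"
    and domain_AE:
      "\<And>f g. f \<in> F \<Longrightarrow> g \<in> borel_measurable M \<Longrightarrow> (AE x in M. f x = g x) \<Longrightarrow> g \<in> F"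
    and domain_zero: "(\<lambda>_. 0) \<in> F"
    and domain_lincomb:
      "\<And>a b f g. f \<in> F \<Longrightarrow> g \<in> F \<Longrightarrow> (\<lambda>x. a * f x + b * g x) \<in> F"
    and domain_dense:
      "\<And>f e. f \<in> Lp M 2 \<Longrightarrow> 0 < e \<Longrightarrow> \<exists>g\<in>F. Lp_norm M 2 (\<lambda>x. f x - g x) < e"
    and form_AE:
      "\<And>f g h. f \<in> F \<Longrightarrow> g \<in> F \<Longrightarrow> h \<in> F \<Longrightarrow> (AE x in M. f x = g x) \<Longrightarrow> E f h = E g h"
    and form_lincomb:
      "\<And>a b f g h. f \<in> F \<Longrightarrow> g \<in> F \<Longrightarrow> h \<in> F \<Longrightarrow>
         E (\<lambda>x. a * f x + b * g x) h = a * E f h + b * E g h"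
    and form_sym: "\<And>f g. f \<in> F \<Longrightarrow> g \<in> F \<Longrightarrow> E f g = E g f"
    and form_nonneg: "\<And>f. f \<in> F \<Longrightarrow> 0 \<le> E f f"
    and form_closed:
      "\<And>u :: nat \<Rightarrow> 'a \<Rightarrow> real.
         (\<And>n. u n \<in> F) \<Longrightarrow>
         (\<And>e. 0 < e \<Longrightarrow> \<exists>N. \<forall>m\<ge>N. \<forall>n\<ge>N.
            form1 M E (\<lambda>x. u m x - u n x) (\<lambda>x. u m x - u n x) < e) \<Longrightarrow>
         \<exists>f\<in>F. (\<lambda>n. form1 M E (\<lambda>x. u n x - f x) (\<lambda>x. u n x - f x)) \<longlonglongrightarrow> 0"
    and form_markov:
      "\<And>f. f \<in> F \<Longrightarrow> (\<lambda>x. min 1 (max 0 (f x))) \<in> F"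
      "\<And>f. f \<in> F \<Longrightarrow> E (\<lambda>x. min 1 (max 0 (f x))) (\<lambda>x. min 1 (max 0 (f x))) \<le> E f f"

text \<open>
  \<open>is_form_generator M F E f g\<close> says that \<open>f\<close> is in the domain of the nonpositive self-adjoint
  operator \<open>L\<close> on \<open>L\<^sup>2\<close> with \<open>E f h = - \<langle>L f, h\<rangle>\<close>, and that \<open>g\<close> represents \<open>L f\<close>.
\<close>

definition is_form_generator ::
  "'a measure \<Rightarrow> ('a \<Rightarrow> real) set \<Rightarrow> (('a \<Rightarrow> real) \<Rightarrow> ('a \<Rightarrow> real) \<Rightarrow> real) \<Rightarrow>
   ('a \<Rightarrow> real) \<Rightarrow> ('a \<Rightarrow> real) \<Rightarrow> bool" where
  "is_form_generator M F E f g \<longleftrightarrow>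
     f \<in> F \<and> g \<in> Lp M 2 \<and> (\<forall>h\<in>F. E f h = - (\<integral>x. g x * h x \<partial>M))"


section \<open>The heat semigroup and its generators\<close>

definition positive_contraction_semigroup ::
  "'a measure \<Rightarrow> ('a \<Rightarrow> real) set \<Rightarrow> (('a \<Rightarrow> real) \<Rightarrow> real) \<Rightarrow>
   (real \<Rightarrow> ('a \<Rightarrow> real) \<Rightarrow> 'a \<Rightarrow> real) \<Rightarrow> bool" where
  "positive_contraction_semigroup M V N P \<longleftrightarrow>
     (\<forall>t\<ge>0. \<forall>f\<in>V. P t f \<in> V) \<and>
     (\<forall>t\<ge>0. \<forall>f\<in>V. \<forall>g\<in>V.
        (AE x in M. f x = g x) \<longrightarrow> (AE x in M. P t f x = P t g x)) \<and>
     (\<forall>t\<ge>0. \<forall>f\<in>V. \<forall>g\<in>V. \<forall>a b.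
        AE x in M. P t (\<lambda>y. a * f y + b * g y) x = a * P t f x + b * P t g x) \<and>
     (\<forall>t\<ge>0. \<forall>f\<in>V. (AE x in M. 0 \<le> f x) \<longrightarrow> (AE x in M. 0 \<le> P t f x)) \<and>
     (\<forall>t\<ge>0. \<forall>f\<in>V. N (P t f) \<le> N f) \<and>
     (\<forall>f\<in>V. AE x in M. P 0 f x = f x) \<and>
     (\<forall>s\<ge>0. \<forall>t\<ge>0. \<forall>f\<in>V. AE x in M. P (s + t) f x = P s (P t f) x)"

definition is_Lp_generator ::
  "'a measure \<Rightarrow> (real \<Rightarrow> ('a \<Rightarrow> real) \<Rightarrow> 'a \<Rightarrow> real) \<Rightarrow> real \<Rightarrow>
   ('a \<Rightarrow> real) \<Rightarrow> ('a \<Rightarrow> real) \<Rightarrow> bool" where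
  "is_Lp_generator M P p f g \<longleftrightarrow>
     f \<in> Lp M p \<and> g \<in> Lp M p \<and>
     ((\<lambda>t. Lp_norm M p (\<lambda>x. (P t f x - f x) / t - g x)) \<longlongrightarrow> 0) (at_right 0)"

definition Lp_domain ::
  "'a measure \<Rightarrow> (real \<Rightarrow> ('a \<Rightarrow> real) \<Rightarrow> 'a \<Rightarrow> real) \<Rightarrow> real \<Rightarrow> ('a \<Rightarrow> real) set" where
  "Lp_domain M P p = {f. \<exists>g. is_Lp_generator M P p f g}"

text \<open>The value is unique up to almost everywhere equality.\<close>

definition Lp_generator ::
  "'a measure \<Rightarrow> (real \<Rightarrow> ('a \<Rightarrow> real) \<Rightarrow> 'a \<Rightarrow> real) \<Rightarrow> real \<Rightarrow> ('a \<Rightarrow> real) \<Rightarrow> 'a \<Rightarrow> real" where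
  "Lp_generator M P p f = (SOME g. is_Lp_generator M P p f g)"

text \<open>
  A single family \<open>P\<close> acts on all the spaces \<open>L\<^sup>p\<close>, so its restrictions to them are automatically
  consistent. The form and the semigroup on \<open>L\<^sup>2\<close> are associated with each other in that they
  have the same generator. As \<open>L\<^sup>p \<inter> L\<^sup>2\<close> is not norm dense in \<open>L\<^sup>\<infinity>\<close>, the extension to
  \<open>L\<^sup>\<infinity>\<close> is singled out by duality with \<open>L\<^sup>1\<close>.
\<close>

locale heat_semigroup = dirichlet_form M F E
  for M :: "'a measure"
    and F :: "('a \<Rightarrow> real) set"
    and E :: "('a \<Rightarrow> real) \<Rightarrow> ('a \<Rightarrow> real) \<Rightarrow> real" +
  fixes P :: "real \<Rightarrow> ('a \<Rightarrow> real) \<Rightarrow> 'a \<Rightarrow> real"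
  assumes generator_L2: "\<And>f g. is_Lp_generator M P 2 f g \<longleftrightarrow> is_form_generator M F E f g"
    and semigroup_Lp:
      "\<And>q. 1 \<le> q \<Longrightarrow> positive_contraction_semigroup M (Lp M q) (Lp_norm M q) P"
    and strongly_continuous_Lp:
      "\<And>q f. 1 \<le> q \<Longrightarrow> f \<in> Lp M q \<Longrightarrow>
         ((\<lambda>t. Lp_norm M q (\<lambda>x. P t f x - f x)) \<longlongrightarrow> 0) (at_right 0)"
    and semigroup_Linf: "positive_contraction_semigroup M (Linf M) (Linf_norm M) P"
    and duality_L1_Linf:
      "\<And>t f g. 0 \<le> t \<Longrightarrow> f \<in> Lp M 1 \<Longrightarrow> g \<in> Linf M \<Longrightarrow>
         (\<integral>x. P t f x * g x \<partial>M) = (\<integral>x. f x * P t g x \<partial>M)"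

definition conservative :: "'a measure \<Rightarrow> (real \<Rightarrow> ('a \<Rightarrow> real) \<Rightarrow> 'a \<Rightarrow> real) \<Rightarrow> bool" where
  "conservative M P \<longleftrightarrow> (\<forall>t\<ge>0. AE x in M. P t (\<lambda>_. 1) x = 1)"

text \<open>\<open>\<kappa> t y\<close> is the heat kernel measure \<open>p\<^sub>t(y, dx)\<close>.\<close>

definition heat_kernel_measures ::
  "'a measure \<Rightarrow> (real \<Rightarrow> ('a \<Rightarrow> real) \<Rightarrow> 'a \<Rightarrow> real) \<Rightarrow> (real \<Rightarrow> 'a \<Rightarrow> 'a measure) \<Rightarrow> bool" where
  "heat_kernel_measures M P \<kappa> \<longleftrightarrow>
     (\<forall>t>0. \<kappa> t \<in> measurable M (subprob_algebra M) \<and>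
        (\<forall>f \<in> Linf M \<union> (\<Union>q\<in>{1..}. Lp M q). AE y in M. P t f y = (\<integral>x. f x \<partial>\<kappa> t y)))"


section \<open>Heat semigroup based Besov spaces\<close>

definition ennreal_powr :: "ennreal \<Rightarrow> real \<Rightarrow> ennreal" where
  "ennreal_powr a r = (if a = \<infinity> then \<infinity> else ennreal (enn2real a powr r))"

definition besov_seminorm ::
  "'a measure \<Rightarrow> (real \<Rightarrow> 'a \<Rightarrow> 'a measure) \<Rightarrow> real \<Rightarrow> real \<Rightarrow> ('a \<Rightarrow> real) \<Rightarrow> ennreal" where
  "besov_seminorm M \<kappa> p \<alpha> f =
     (SUP t\<in>{0<..}. ennreal (t powr (- \<alpha>)) *
        ennreal_powr (\<integral>\<^sup>+ y. (\<integral>\<^sup>+ x. ennreal (\<bar>f x - f y\<bar> powr p) \<partial>\<kappa> t y) \<partial>M) (1 / p))"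

definition besov_space ::
  "'a measure \<Rightarrow> (real \<Rightarrow> 'a \<Rightarrow> 'a measure) \<Rightarrow> real \<Rightarrow> real \<Rightarrow> ('a \<Rightarrow> real) set" where
  "besov_space M \<kappa> p \<alpha> = {f \<in> Lp M p. besov_seminorm M \<kappa> p \<alpha> f < \<infinity>}"

end

theory Submission
  imports Defs
begin

text \<open>
  Put \<open>\<phi>(a) = sgn a \<bar>a\<bar>\<^sup>p\<^sup>-\<^sup>1\<close>. For \<open>1 < p \<le> 2\<close> the product \<open>A(a, b) = (a - b) (\<phi>(a) - \<phi>(b))\<close> dominates
  \<open>(a - b)\<^sup>2 max(\<bar>a\<bar>, \<bar>b\<bar>)\<^sup>p\<^sup>-\<^sup>2\<close> up to a constant, so that for every \<open>s > 0\<close>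
  \<open>\<bar>a - b\<bar>\<^sup>p \<le> C s\<^sup>p\<^sup>/\<^sup>2\<^sup>-\<^sup>1 A(a, b) + s\<^sup>p\<^sup>/\<^sup>2 (\<bar>a\<bar>\<^sup>p + \<bar>b\<bar>\<^sup>p)\<close>. Integrating with \<open>a = f(x)\<close>, \<open>b = f(y)\<close> against
  \<open>p\<^sub>t(y, dx) d\<mu>(y)\<close>, the last bracket contributes at most \<open>2 \<parallel>f\<parallel>\<^sup>p\<close>, and symmetry of \<open>P\<^sub>t\<close> bounds the
  integral of \<open>A\<close> by \<open>2 \<integral> (f - P\<^sub>t f) \<phi>(f) d\<mu> \<le> 2 t \<parallel>L f\<parallel> \<parallel>f\<parallel>\<^sup>p\<^sup>-\<^sup>1\<close>. Optimizing over \<open>s\<close> gives the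
  estimate \<open>C (t \<parallel>L f\<parallel> \<parallel>f\<parallel>)\<^sup>p\<^sup>/\<^sup>2\<close>.
\<close>

section \<open>Minkowski and Hoelder inequalities\<close>

text \<open>Convexity of \<open>z powr p\<close> at \<open>x / a\<close> and \<open>y / b\<close>
  with weights \<open>a / (a + b)\<close> and \<open>b / (a + b)\<close>. With \<open>a\<close> and
  \<open>b\<close> close to the norms of two functions, integration yields Minkowski's
  inequality.\<close>

lemma powr_add_le:
  fixes x y a b p :: real
  assumes "1 \<le> p" "0 \<le> x" "0 \<le> y" "0 < a" "0 < b"
  shows "(x + y) powr p \<le> (a + b) powr (p - 1) * (a * (x / a) powr p + b * (y / b) powr p)"
proof -
  \<comment> \<open>Replaces convexity when \<open>x\<close> or \<open>y\<close> is zero, so that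
    the convexity step only sees positive points.\<close>
  have shrink: "(c * z) powr p \<le> c * z powr p" if "0 \<le> c" "c \<le> 1" "0 \<le> z" for c z :: real
  proof -
    have "c powr p \<le> c"
      using powr_mono'[of 1 p c] that assms by (cases "c = 0") auto
    then show ?thesis
      using that by (simp add: powr_mult mult_right_mono)
  qed
  define l where "l = a / (a + b)"
  have l: "0 < l" "l < 1" "1 - l = b / (a + b)"
    using assms by (auto simp: l_def field_simps)
  have "(l * (x / a) + (1 - l) * (y / b)) powr p \<le> l * (x / a) powr p + (1 - l) * (y / b) powr p"
  proof (cases "x = 0 \<or> y = 0")
    case True
    then show ?thesis
      using shrink[of l "x / a"] shrink[of "1 - l" "y / b"] l assms by auto
  next
    case False
    then show ?thesis
      using convex_onD[OF powr_convex[OF assms(1)], of "1 - l" "x / a" "y / b"] l(1,2) assms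
      by auto
  qed
  also have "l * (x / a) + (1 - l) * (y / b) = (x + y) / (a + b)"
    using assms unfolding l(3) unfolding l_def by (simp add: add_divide_distrib)
  also have "((x + y) / (a + b)) powr p = (x + y) powr p / (a + b) powr p"
    using assms by (simp add: powr_divide)
  also have "l * (x / a) powr p + (1 - l) * (y / b) powr p
      = (a * (x / a) powr p + b * (y / b) powr p) / (a + b)"
    unfolding l(3) unfolding l_def by (simp add: add_divide_distrib)
  finally have "(x + y) powr p / (a + b) powr p
      \<le> (a * (x / a) powr p + b * (y / b) powr p) / (a + b)" .
  moreover have "(a + b) powr p = (a + b) powr (p - 1) * (a + b)"
    using assms by (simp add: powr_diff)
  moreover have "0 < (a + b) powr p"
    using assms by simp
  ultimately have "(x + y) powr p
      \<le> (a * (x / a) powr p + b * (y / b) powr p) / (a + b) * ((a + b) powr (p - 1) * (a + b))"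
    by (metis pos_divide_le_eq)
  then show ?thesis
    using assms by (simp add: mult.commute)
qed

section \<open>Elementary facts on L^p and its norm\<close>

lemma Lp_norm_nonneg: "0 \<le> Lp_norm M p f"
  by (simp add: Lp_norm_def)

lemma Lp_norm_powr: "p \<noteq> 0 \<Longrightarrow> Lp_norm M p f powr p = (\<integral>x. \<bar>f x\<bar> powr p \<partial>M)"
  by (simp add: Lp_norm_def powr_powr)

lemma Lp_norm_leI:
  assumes "0 < p" "0 \<le> c" "(\<integral>x. \<bar>f x\<bar> powr p \<partial>M) \<le> c powr p"
  shows "Lp_norm M p f \<le> c"
  using powr_mono2[of "1 / p", OF _ _ assms(3)] assms by (simp add: Lp_norm_def powr_powr)

lemma Lp_norm_normalized:
  assumes "0 < p" "Lp_norm M p h \<le> c" "0 < c"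
  shows "(\<integral>x. (\<bar>h x\<bar> / c) powr p \<partial>M) \<le> 1"
proof -
  have "(\<integral>x. \<bar>h x\<bar> powr p \<partial>M) \<le> c powr p"
    using powr_mono2[OF _ Lp_norm_nonneg assms(2), of p] assms by (simp add: Lp_norm_powr)
  then show ?thesis
    using assms by (simp add: powr_divide)
qed

lemma Lp_norm_mult:
  assumes "0 < p"
  shows "Lp_norm M p (\<lambda>x. c * f x) = \<bar>c\<bar> * Lp_norm M p f"
  using assms by (simp add: Lp_norm_def abs_mult powr_mult powr_powr)

lemma Lp_norm_cong_AE:
  assumes "f \<in> borel_measurable M" "g \<in> borel_measurable M" "AE x in M. f x = g x"
  shows "Lp_norm M p f = Lp_norm M p g"
  unfolding Lp_norm_def
  by (rule arg_cong[where f = "\<lambda>z. z powr (1 / p)"], rule integral_cong_AE) (use assms in auto)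

lemma Lp_borel: "f \<in> Lp M p \<Longrightarrow> f \<in> borel_measurable M"
  by (simp add: Lp_def)

lemma Lp_integrable: "f \<in> Lp M p \<Longrightarrow> integrable M (\<lambda>x. \<bar>f x\<bar> powr p)"
  by (simp add: Lp_def)

lemma Lp_mult: "f \<in> Lp M p \<Longrightarrow> (\<lambda>x. c * f x) \<in> Lp M p"
  by (auto simp: Lp_def abs_mult powr_mult)

lemma Lp_add:
  assumes "1 \<le> p" "f \<in> Lp M p" "g \<in> Lp M p"
  shows "(\<lambda>x. f x + g x) \<in> Lp M p"
proof -
  note [measurable] = Lp_borel[OF assms(2)] Lp_borel[OF assms(3)]
  have "integrable M (\<lambda>x. \<bar>f x + g x\<bar> powr p)"
  proof (rule Bochner_Integration.integrable_bound)
    show "integrable M (\<lambda>x. 2 powr (p - 1) * (\<bar>f x\<bar> powr p + \<bar>g x\<bar> powr p))"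
      using assms by (auto intro: Lp_integrable)
    have "\<bar>f x + g x\<bar> powr p \<le> (\<bar>f x\<bar> + \<bar>g x\<bar>) powr p" for x
      using assms by (intro powr_mono2) auto
    moreover have "(\<bar>f x\<bar> + \<bar>g x\<bar>) powr p \<le> 2 powr (p - 1) * (\<bar>f x\<bar> powr p + \<bar>g x\<bar> powr p)" for x
      using powr_add_le[OF assms(1), of "\<bar>f x\<bar>" "\<bar>g x\<bar>" 1 1] by simp
    ultimately show "AE x in M. norm (\<bar>f x + g x\<bar> powr p)
        \<le> norm (2 powr (p - 1) * (\<bar>f x\<bar> powr p + \<bar>g x\<bar> powr p))"
      by (auto intro: order_trans)
  qed simp
  then show ?thesis
    by (simp add: Lp_def)
qed

lemma Lp_diff:
  assumes "1 \<le> p" "f \<in> Lp M p" "g \<in> Lp M p"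
  shows "(\<lambda>x. f x - g x) \<in> Lp M p"
  using Lp_add[OF assms(1,2) Lp_mult[OF assms(3), of "-1"]] by simp

text \<open>Integrate \<open>powr_add_le\<close> with weights just above the two norms: each
  normalized integral is at most one, so the right-hand side collapses to
  \<open>(a + b) powr p\<close>.\<close>

lemma Minkowski_Lp_norm:
  assumes p: "1 \<le> p" and f: "f \<in> Lp M p" and g: "g \<in> Lp M p"
  shows "Lp_norm M p (\<lambda>x. f x + g x) \<le> Lp_norm M p f + Lp_norm M p g"
proof (rule field_le_epsilon)
  fix e :: real
  assume e: "0 < e"
  note int = Lp_integrable[OF f] Lp_integrable[OF g]
  \<comment> \<open>The extra \<open>e / 2\<close> keeps the weights positive even if a norm
    vanishes.\<close>
  define a where "a = Lp_norm M p f + e / 2"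
  define b where "b = Lp_norm M p g + e / 2"
  have ab: "0 < a" "0 < b"
    using e Lp_norm_nonneg[of M p f] Lp_norm_nonneg[of M p g] by (auto simp: a_def b_def)
  have "Lp_norm M p (\<lambda>x. f x + g x) \<le> a + b"
  proof (rule Lp_norm_leI)
    have "(\<integral>x. \<bar>f x + g x\<bar> powr p \<partial>M) \<le>
        (\<integral>x. (a + b) powr (p - 1) * (a * (\<bar>f x\<bar> / a) powr p + b * (\<bar>g x\<bar> / b) powr p) \<partial>M)"
    proof (rule integral_mono)
      show "\<bar>f x + g x\<bar> powr p
          \<le> (a + b) powr (p - 1) * (a * (\<bar>f x\<bar> / a) powr p + b * (\<bar>g x\<bar> / b) powr p)" for x
        by (rule order_trans[OF powr_mono2 powr_add_le]) (use p ab in auto)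
    qed (use int ab Lp_integrable[OF Lp_add[OF p f g]] in \<open>auto simp: powr_divide\<close>)
    also have "\<dots> = (a + b) powr (p - 1) *
        (a * (\<integral>x. (\<bar>f x\<bar> / a) powr p \<partial>M) + b * (\<integral>x. (\<bar>g x\<bar> / b) powr p \<partial>M))"
      using int ab by (simp add: powr_divide)
    also have "\<dots> \<le> (a + b) powr (p - 1) * (a * 1 + b * 1)"
      using ab e p by (intro mult_left_mono add_mono Lp_norm_normalized) (auto simp: a_def b_def)
    also have "\<dots> = (a + b) powr p"
      using ab by (simp add: powr_diff)
    finally show "(\<integral>x. \<bar>f x + g x\<bar> powr p \<partial>M) \<le> (a + b) powr p" .
  qed (use p ab in auto)
  then show "Lp_norm M p (\<lambda>x. f x + g x) \<le> Lp_norm M p f + Lp_norm M p g + e"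
    by (simp add: a_def b_def)
qed

text \<open>Young's inequality with exponents \<open>p\<close> and \<open>p / (p - 1)\<close>,
  applied to \<open>x / a\<close> and \<open>(y / b) powr (p - 1)\<close> and scaled back.\<close>

lemma mult_powr_le:
  fixes p a b x y :: real
  assumes p: "1 < p" and "0 < a" "0 < b" "0 \<le> x" "0 \<le> y"
  shows "x * y powr (p - 1)
    \<le> a * b powr (p - 1) * ((x / a) powr p / p + (y / b) powr p * (p - 1) / p)"
proof -
  have "(x / a) * ((y / b) powr (p - 1))
      \<le> (x / a) powr p / p + ((y / b) powr (p - 1)) powr (p / (p - 1)) / (p / (p - 1))"
    by (rule Youngs_inequality) (use assms in \<open>auto simp: field_simps\<close>)
  then have "(x / a) * ((y / b) powr (p - 1)) \<le> (x / a) powr p / p + (y / b) powr p * (p - 1) / p"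
    using p by (simp add: powr_powr)
  then have "a * b powr (p - 1) * ((x / a) * (y powr (p - 1) / b powr (p - 1)))
      \<le> a * b powr (p - 1) * ((x / a) powr p / p + (y / b) powr p * (p - 1) / p)"
    using assms by (intro mult_left_mono) (auto simp: powr_divide)
  then show ?thesis
    using assms by simp
qed

lemma mult_powr_le_add:
  fixes p x y :: real
  assumes "1 < p" "0 \<le> x" "0 \<le> y"
  shows "x * y powr (p - 1) \<le> x powr p + y powr p"
proof -
  have "x powr p / p \<le> x powr p" "y powr p * (p - 1) / p \<le> y powr p"
    using assms mult_left_mono[of 1 p "x powr p"] by (simp_all add: divide_le_eq mult_left_mono)
  then show ?thesis
    using mult_powr_le[of p 1 1 x y] assms by simp
qed

text \<open>The conjugate function enters as \<open>\<bar>f\<bar> powr (p - 1)\<close>, whose norm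
  in the conjugate exponent is \<open>Lp_norm M p f powr (p - 1)\<close>. The proof integrates
  \<open>mult_powr_le\<close> with scales \<open>e\<close> above the norms and lets \<open>e\<close>
  tend to zero.\<close>

lemma Hoelder_Lp_norm:
  assumes p: "1 < p" and f: "f \<in> Lp M p" and g: "g \<in> Lp M p"
  shows "(\<integral>x. \<bar>g x\<bar> * \<bar>f x\<bar> powr (p - 1) \<partial>M) \<le> Lp_norm M p g * Lp_norm M p f powr (p - 1)"
proof -
  note int = Lp_integrable[OF f] Lp_integrable[OF g]
  note [measurable] = Lp_borel[OF f] Lp_borel[OF g]
  have bound: "(\<integral>x. \<bar>g x\<bar> * \<bar>f x\<bar> powr (p - 1) \<partial>M)
      \<le> (Lp_norm M p g + e) * (Lp_norm M p f + e) powr (p - 1)" if "0 < e" for e :: real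
  proof -
    define a where "a = Lp_norm M p g + e"
    define b where "b = Lp_norm M p f + e"
    have ab: "0 < a" "0 < b"
      using that Lp_norm_nonneg[of M p f] Lp_norm_nonneg[of M p g] by (auto simp: a_def b_def)
    have "integrable M (\<lambda>x. \<bar>g x\<bar> * \<bar>f x\<bar> powr (p - 1))"
      by (rule Bochner_Integration.integrable_bound[OF Bochner_Integration.integrable_add[OF int(2,1)]])
        (use mult_powr_le_add[OF p] in auto)
    then have "(\<integral>x. \<bar>g x\<bar> * \<bar>f x\<bar> powr (p - 1) \<partial>M) \<le> (\<integral>x. a * b powr (p - 1) *
        ((\<bar>g x\<bar> / a) powr p / p + (\<bar>f x\<bar> / b) powr p * (p - 1) / p) \<partial>M)"
      using int ab by (intro integral_mono mult_powr_le[OF p]) (auto simp: powr_divide)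
    also have "\<dots> = a * b powr (p - 1) *
        ((\<integral>x. (\<bar>g x\<bar> / a) powr p \<partial>M) / p + (\<integral>x. (\<bar>f x\<bar> / b) powr p \<partial>M) * (p - 1) / p)"
      using int ab by (simp add: powr_divide)
    also have "\<dots> \<le> a * b powr (p - 1) * (1 / p + 1 * (p - 1) / p)"
      using ab p that
      by (intro mult_left_mono add_mono divide_right_mono mult_right_mono Lp_norm_normalized) (auto simp: a_def b_def)
    also have "1 / p + 1 * (p - 1) / p = 1"
      using p by (simp add: field_simps)
    finally show ?thesis
      by (simp add: a_def b_def)
  qed
  \<comment> \<open>Continuity of the power holds down to base zero because the exponent
    \<open>p - 1\<close> is positive and the base stays nonnegative.\<close>
  have "((\<lambda>e. (Lp_norm M p g + e) * (Lp_norm M p f + e) powr (p - 1)) \<longlongrightarrow>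
      (Lp_norm M p g + 0) * (Lp_norm M p f + 0) powr (p - 1)) (at_right 0)"
  proof (intro tendsto_mult tendsto_add tendsto_const tendsto_powr')
    show "Lp_norm M p f + 0 \<noteq> 0 \<or>
        0 < p - 1 \<and> (\<forall>\<^sub>F e in at_right 0. 0 \<le> Lp_norm M p f + e)"
      using p Lp_norm_nonneg[of M p f]
      by (auto intro!: eventually_mono[OF eventually_at_right_less[of 0]])
  qed auto
  moreover have "\<forall>\<^sub>F e in at_right 0. (\<integral>x. \<bar>g x\<bar> * \<bar>f x\<bar> powr (p - 1) \<partial>M)
      \<le> (Lp_norm M p g + e) * (Lp_norm M p f + e) powr (p - 1)"
    using eventually_at_right_less[of 0] by eventually_elim (rule bound)
  ultimately show ?thesis
    by (intro tendsto_lowerbound) auto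
qed

section \<open>Increments of the semigroup\<close>

lemmas semigroup_mem =
  positive_contraction_semigroup_def[THEN iffD1, THEN conjunct1, rule_format]

lemmas semigroup_lincomb =
  positive_contraction_semigroup_def[THEN iffD1, THEN conjunct2, THEN conjunct2, THEN conjunct1, rule_format]

lemmas semigroup_contraction =
  positive_contraction_semigroup_def[THEN iffD1, THEN conjunct2, THEN conjunct2, THEN conjunct2, THEN conjunct2, THEN conjunct1, rule_format]

lemmas semigroup_add =
  positive_contraction_semigroup_def[THEN iffD1, THEN conjunct2, THEN conjunct2, THEN conjunct2, THEN conjunct2, THEN conjunct2, THEN conjunct2, rule_format]

text \<open>
  The function \<open>t \<mapsto> \<parallel>P\<^sub>t f - f\<parallel>\<close> is subadditive and behaves like \<open>t \<parallel>L f\<parallel>\<close> at \<open>0\<close>; comparing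
  \<open>t\<close> with \<open>n\<close> steps of length \<open>t / n\<close> avoids integrating \<open>P\<^sub>s L f\<close> in \<open>s\<close>.
\<close>

lemma generator_increment_le:
  assumes p: "1 \<le> p" and S: "positive_contraction_semigroup M (Lp M p) (Lp_norm M p) P"
    and gen: "is_Lp_generator M P p f g" and t: "0 < t"
  shows "Lp_norm M p (\<lambda>x. P t f x - f x) \<le> t * Lp_norm M p g"
proof -
  have f: "f \<in> Lp M p" and g: "g \<in> Lp M p"
    and lim: "((\<lambda>t. Lp_norm M p (\<lambda>x. (P t f x - f x) / t - g x)) \<longlongrightarrow> 0) (at_right 0)"
    using gen by (auto simp: is_Lp_generator_def)
  define a where "a t = Lp_norm M p (\<lambda>x. P t f x - f x)" for t
  note PL = semigroup_mem[OF S]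
  have subadd: "a (s + t) \<le> a s + a t" if "0 \<le> s" "0 \<le> t" for s t
  proof -
    have m: "P t f \<in> Lp M p" "P s f \<in> Lp M p" "P (s + t) f \<in> Lp M p" "P s (P t f) \<in> Lp M p"
      using PL f that by auto
    have d: "(\<lambda>x. P t f x - f x) \<in> Lp M p"
      using Lp_diff[OF p] m f by blast
    note [measurable] = m[THEN Lp_borel] f[THEN Lp_borel] PL[OF that(1) d, THEN Lp_borel]
    note lin = semigroup_lincomb[OF S that(1) m(1) f, of 1 "-1"]
    note comp = semigroup_add[OF S that f]
    \<comment> \<open>By linearity and the semigroup law, the increment over \<open>s + t\<close> is
      \<open>P s\<close> of the increment over \<open>t\<close> plus the increment over
      \<open>s\<close>; contractivity then removes \<open>P s\<close>.\<close>
    have "a (s + t) = Lp_norm M p (\<lambda>x. P s (\<lambda>y. P t f y - f y) x + (P s f x - f x))"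
      unfolding a_def
    proof (rule Lp_norm_cong_AE)
      show "AE x in M. P (s + t) f x - f x = P s (\<lambda>y. P t f y - f y) x + (P s f x - f x)"
        using lin comp by eventually_elim simp
    qed measurable
    also have "\<dots> \<le> Lp_norm M p (P s (\<lambda>y. P t f y - f y)) + a s"
      unfolding a_def by (rule Minkowski_Lp_norm) (use p m f d PL that in \<open>auto intro: Lp_diff\<close>)
    also have "Lp_norm M p (P s (\<lambda>y. P t f y - f y)) \<le> a t"
      unfolding a_def by (rule semigroup_contraction[OF S that(1) d])
    finally show ?thesis
      by simp
  qed
  have mult: "a (real (Suc n) * h) \<le> real (Suc n) * a h" if "0 \<le> h" for n h
  proof (induction n)
    case (Suc n)
    have "a (real (Suc (Suc n)) * h) = a (h + real (Suc n) * h)"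
      by (simp add: algebra_simps)
    also have "\<dots> \<le> a h + real (Suc n) * a h"
      using subadd[of h "real (Suc n) * h"] that Suc by simp
    finally show ?case
      by (simp add: algebra_simps)
  qed simp
  define e where "e h = Lp_norm M p (\<lambda>x. (P h f x - f x) / h - g x)" for h
  \<comment> \<open>Minkowski applied to the difference quotient, written as its deviation from
    \<open>g\<close> plus \<open>g\<close>; the error \<open>e h\<close> vanishes as
    \<open>h\<close> tends to zero from the right.\<close>
  have small: "a h \<le> h * (e h + Lp_norm M p g)" if "0 < h" for h
  proof -
    have q: "(\<lambda>x. (P h f x - f x) / h) \<in> Lp M p"
      using Lp_mult[OF Lp_diff[OF p PL f], of h f "1 / h"] that f by simp
    have "a h = h * Lp_norm M p (\<lambda>x. (P h f x - f x) / h)"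
      using Lp_norm_mult[of p M h "\<lambda>x. (P h f x - f x) / h"] p that by (simp add: a_def)
    also have "Lp_norm M p (\<lambda>x. (P h f x - f x) / h) \<le> e h + Lp_norm M p g"
      using Minkowski_Lp_norm[OF p Lp_diff[OF p q g] g] by (simp add: e_def)
    finally show ?thesis
      using that by simp
  qed
  \<comment> \<open>With \<open>Suc n\<close> equal steps the number of steps cancels against the
    step length, and only the error \<open>e\<close> at a vanishing step remains.\<close>
  have "a t \<le> t * (e (t / real (Suc n)) + Lp_norm M p g)" for n
  proof -
    have "a t \<le> real (Suc n) * a (t / real (Suc n))"
      using mult[of "t / real (Suc n)" n] t by simp
    also have "\<dots> \<le> real (Suc n) * (t / real (Suc n) * (e (t / real (Suc n)) + Lp_norm M p g))"
      using small[of "t / real (Suc n)"] t by (intro mult_left_mono) auto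
    finally show ?thesis
      by simp
  qed
  moreover have "(\<lambda>n. t * (e (t / real (Suc n)) + Lp_norm M p g)) \<longlonglongrightarrow> t * (0 + Lp_norm M p g)"
  proof -
    have "(\<lambda>n. t / real (Suc n)) \<longlonglongrightarrow> 0"
      using LIMSEQ_Suc[OF lim_const_over_n[of t]] by simp
    then have "filterlim (\<lambda>n. t / real (Suc n)) (at_right 0) sequentially"
      using t by (auto simp: filterlim_at)
    then have "(\<lambda>n. e (t / real (Suc n))) \<longlonglongrightarrow> 0"
      unfolding e_def by (rule filterlim_compose[OF lim])
    then show ?thesis
      by (intro tendsto_intros)
  qed
  ultimately have "a t \<le> t * (0 + Lp_norm M p g)"
    by (intro LIMSEQ_le_const) auto
  then show ?thesis
    by (simp add: a_def)
qed

section \<open>Signed powers\<close>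

text \<open>For \<open>q = p - 1\<close> this is \<phi>, the derivative of
  \<open>\<bar>a\<bar> powr p\<close> up to the factor \<open>p\<close>.\<close>

definition signed_powr :: "real \<Rightarrow> real \<Rightarrow> real" where
  "signed_powr q a = sgn a * \<bar>a\<bar> powr q"

lemma signed_powr_measurable[measurable]: "signed_powr q \<in> borel_measurable borel"
  unfolding signed_powr_def by measurable

lemma abs_signed_powr: "\<bar>signed_powr q a\<bar> = \<bar>a\<bar> powr q"
  by (auto simp: signed_powr_def abs_mult sgn_if)

lemma signed_powr_minus: "signed_powr q (- a) = - signed_powr q a"
  by (simp add: signed_powr_def sgn_if)

lemma mult_signed_powr: "a * signed_powr (p - 1) a = \<bar>a\<bar> powr p"
proof -
  have "a * signed_powr (p - 1) a = \<bar>a\<bar> * \<bar>a\<bar> powr (p - 1)"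
    by (simp add: signed_powr_def sgn_if)
  then show ?thesis
    by (cases "a = 0") (simp_all add: powr_diff)
qed

text \<open>By oddness it suffices to treat \<open>0 < a\<close>. For nonnegative \<open>b\<close>
  the concave power \<open>p - 1\<close> lies below its tangent at \<open>a\<close>, which gives the
  constant \<open>p - 1\<close>; for negative \<open>b\<close> a crude bound costs the factor one
  half.\<close>

lemma signed_powr_diff_ge:
  fixes p a b :: real
  assumes p: "1 < p" "p \<le> 2" and ba: "\<bar>b\<bar> \<le> \<bar>a\<bar>" and "a \<noteq> 0"
  shows "(p - 1) / 2 * (\<bar>a - b\<bar>\<^sup>2 * \<bar>a\<bar> powr (p - 2))
    \<le> (a - b) * (signed_powr (p - 1) a - signed_powr (p - 1) b)"
proof -
  have main: "(p - 1) / 2 * ((c - d)\<^sup>2 * c powr (p - 2))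
      \<le> (c - d) * (signed_powr (p - 1) c - signed_powr (p - 1) d)"
    if c: "0 < c" and d: "\<bar>d\<bar> \<le> c" for c d :: real
  proof -
    have expand: "c powr (p - 1) = c * c powr (p - 2)"
      using powr_add[of c 1 "p - 2"] c by simp
    have "(p - 1) / 2 * ((c - d) * c powr (p - 2))
        \<le> signed_powr (p - 1) c - signed_powr (p - 1) d"
    proof (cases "0 \<le> d")
      case True
      have "d powr (p - 1) \<le> (p - 1) * d * c powr (p - 2) + (2 - p) * c powr (p - 1)"
      proof (cases "d = 0")
        case False
        \<comment> \<open>Weighted arithmetic-geometric mean inequality with weights
          \<open>p - 1\<close> and \<open>2 - p\<close>; multiplied by \<open>c powr (p - 2)\<close>
          it is the tangent bound at \<open>c\<close>.\<close>
        have "d powr (p - 1) * c powr (2 - p) \<le> (p - 1) * d + (2 - p) * c"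
          by (rule Youngs_inequality_0) (use p c True False in auto)
        then have "d powr (p - 1) * c powr (2 - p) * c powr (p - 2)
            \<le> ((p - 1) * d + (2 - p) * c) * c powr (p - 2)"
          by (rule mult_right_mono) simp
        moreover have "c powr (2 - p) * c powr (p - 2) = 1"
          using c by (simp flip: powr_add)
        ultimately show ?thesis
          by (simp add: expand algebra_simps)
      qed (use p in auto)
      then have "(p - 1) * ((c - d) * c powr (p - 2)) \<le> c powr (p - 1) - d powr (p - 1)"
        by (simp add: expand algebra_simps)
      moreover have "0 \<le> (p - 1) * ((c - d) * c powr (p - 2))"
        using p d by simp
      moreover have "signed_powr (p - 1) c = c powr (p - 1)" "signed_powr (p - 1) d = d powr (p - 1)"
        using c True by (auto simp: signed_powr_def sgn_if)
      ultimately show ?thesis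
        by (simp add: field_simps)
    next
      case False
      \<comment> \<open>Here \<open>c - d \<le> 2 * c\<close> and \<open>p - 1 \<le> 1\<close>,
        while a negative \<open>d\<close> only increases the difference of the signed
        powers.\<close>
      have "(p - 1) / 2 * ((c - d) * c powr (p - 2)) \<le> 1 / 2 * ((2 * c) * c powr (p - 2))"
        using p c d by (intro mult_mono) auto
      also have "\<dots> = c powr (p - 1)"
        by (simp add: expand)
      also have "\<dots> \<le> signed_powr (p - 1) c - signed_powr (p - 1) d"
        using c False by (auto simp: signed_powr_def sgn_if)
      finally show ?thesis .
    qed
    then have "(c - d) * ((p - 1) / 2 * ((c - d) * c powr (p - 2)))
        \<le> (c - d) * (signed_powr (p - 1) c - signed_powr (p - 1) d)"
      using d by (intro mult_left_mono) auto
    moreover have "(c - d) * ((p - 1) / 2 * ((c - d) * c powr (p - 2)))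
        = (p - 1) / 2 * ((c - d)\<^sup>2 * c powr (p - 2))"
      by (simp add: power2_eq_square)
    ultimately show ?thesis
      by (simp only:)
  qed
  show ?thesis
  proof (cases "0 < a")
    case True
    then show ?thesis
      using main[of a b] ba by simp
  next
    case False
    then show ?thesis
      using main[of "- a" "- b"] ba \<open>a \<noteq> 0\<close>
      by (simp add: signed_powr_minus power2_commute algebra_simps)
  qed
qed

text \<open>Compare \<open>d\<close> with \<open>sqrt s * m\<close>. If \<open>d\<close> is at most
  this, the last term alone dominates. Otherwise \<open>d powr (p - 2)\<close> is at most the same
  power of \<open>sqrt s * m\<close>, the exponent not being positive, and the first term alone
  dominates.\<close>

lemma powr_le_interpolation:
  fixes p s d m :: real
  assumes p: "0 < p" "p \<le> 2" and "0 < s" "0 \<le> d" "0 < m"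
  shows "d powr p \<le> s powr (p / 2 - 1) * (d\<^sup>2 * m powr (p - 2)) + s powr (p / 2) * m powr p"
proof (cases "d\<^sup>2 \<le> s * m\<^sup>2")
  case True
  have pw: "(x\<^sup>2) powr (r / 2) = x powr r" if "0 \<le> x" for x r :: real
    using that by (simp add: powr_powr flip: powr_numeral)
  have "(d\<^sup>2) powr (p / 2) \<le> (s * m\<^sup>2) powr (p / 2)"
    using True p by (intro powr_mono2) auto
  then have "d powr p \<le> s powr (p / 2) * m powr p"
    using assms by (simp add: pw powr_mult)
  then show ?thesis
    using assms by (simp add: add_increasing)
next
  case False
  have "0 < d"
    using False assms by (cases "d = 0") auto
  have pw: "(x\<^sup>2) powr (p / 2 - 1) = x powr (p - 2)" if "0 < x" for x :: real
    using that by (simp add: powr_powr diff_divide_distrib algebra_simps flip: powr_numeral)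
  have "(d\<^sup>2) powr (p / 2 - 1) \<le> (s * m\<^sup>2) powr (p / 2 - 1)"
    using False assms by (intro powr_mono2') auto
  then have "d\<^sup>2 * d powr (p - 2) \<le> d\<^sup>2 * (s powr (p / 2 - 1) * m powr (p - 2))"
    using assms \<open>0 < d\<close> by (intro mult_left_mono) (simp_all add: pw powr_mult)
  moreover have "d\<^sup>2 * d powr (p - 2) = d powr p"
    using \<open>0 < d\<close> by (simp add: powr_diff)
  moreover have "d\<^sup>2 * (s powr (p / 2 - 1) * m powr (p - 2))
      = s powr (p / 2 - 1) * (d\<^sup>2 * m powr (p - 2))"
    by (simp only: mult.left_commute)
  moreover have "0 \<le> s powr (p / 2) * m powr p"
    by simp
  ultimately show ?thesis
    by linarith
qed

text \<open>Use \<open>powr_le_interpolation\<close> with \<open>m\<close> the larger of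
  \<open>\<bar>a\<bar>\<close> and \<open>\<bar>b\<bar>\<close>, then trade the quadratic term for
  the product by \<open>signed_powr_diff_ge\<close>. Both sides are symmetric in \<open>a\<close>
  and \<open>b\<close>, so \<open>\<bar>b\<bar> \<le> \<bar>a\<bar>\<close> may be assumed;
  \<open>a = 0\<close> then forces \<open>b = 0\<close>.\<close>

lemma abs_diff_powr_le:
  fixes p s a b :: real
  assumes p: "1 < p" "p \<le> 2" and s: "0 < s"
  shows "\<bar>a - b\<bar> powr p
    \<le> 2 / (p - 1) * s powr (p / 2 - 1) * ((a - b) * (signed_powr (p - 1) a - signed_powr (p - 1) b))
      + s powr (p / 2) * (\<bar>a\<bar> powr p + \<bar>b\<bar> powr p)"
proof -
  have main: "\<bar>a - b\<bar> powr p
    \<le> 2 / (p - 1) * s powr (p / 2 - 1) * ((a - b) * (signed_powr (p - 1) a - signed_powr (p - 1) b))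
      + s powr (p / 2) * (\<bar>a\<bar> powr p + \<bar>b\<bar> powr p)" if ba: "\<bar>b\<bar> \<le> \<bar>a\<bar>" for a b
  proof (cases "a = 0")
    case False
    let ?A = "(a - b) * (signed_powr (p - 1) a - signed_powr (p - 1) b)"
    have "\<bar>a - b\<bar>\<^sup>2 * \<bar>a\<bar> powr (p - 2) \<le> 2 / (p - 1) * ?A"
      using signed_powr_diff_ge[OF p ba False] p by (simp add: field_simps)
    then have "s powr (p / 2 - 1) * (\<bar>a - b\<bar>\<^sup>2 * \<bar>a\<bar> powr (p - 2))
        \<le> s powr (p / 2 - 1) * (2 / (p - 1) * ?A)"
      by (rule mult_left_mono) simp
    moreover have "s powr (p / 2) * \<bar>a\<bar> powr p \<le> s powr (p / 2) * (\<bar>a\<bar> powr p + \<bar>b\<bar> powr p)"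
      by (intro mult_left_mono) auto
    moreover have "\<bar>a - b\<bar> powr p \<le> s powr (p / 2 - 1) * (\<bar>a - b\<bar>\<^sup>2 * \<bar>a\<bar> powr (p - 2))
        + s powr (p / 2) * \<bar>a\<bar> powr p"
      by (rule powr_le_interpolation) (use p s False in auto)
    moreover have "s powr (p / 2 - 1) * (2 / (p - 1) * ?A) = 2 / (p - 1) * s powr (p / 2 - 1) * ?A"
      by (simp only: mult_ac)
    ultimately show ?thesis
      by linarith
  qed (use ba in auto)
  show ?thesis
  proof (cases "\<bar>b\<bar> \<le> \<bar>a\<bar>")
    case False
    then show ?thesis
      using main[of a b] by (simp add: abs_minus_commute algebra_simps)
  qed (rule main)
qed

section \<open>Measures defined by a kernel\<close>

text \<open>
  The measure \<open>p\<^sub>t(y, dx) d\<mu>(y)\<close> at the point \<open>(x, y)\<close>: the kernel variable comes first.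
  The bind is used with a measure that need not be a probability, nor even \<open>\<sigma>\<close>-finite.
\<close>

definition kernel_graph :: "'a measure \<Rightarrow> ('a \<Rightarrow> 'a measure) \<Rightarrow> ('a \<times> 'a) measure" where
  "kernel_graph M k = M \<bind> (\<lambda>y. distr (k y) (M \<Otimes>\<^sub>M M) (\<lambda>x. (x, y)))"

context
  fixes M :: "'a measure" and k :: "'a \<Rightarrow> 'a measure"
  assumes k[measurable]: "k \<in> measurable M (subprob_algebra M)" and ne: "space M \<noteq> {}"
begin

lemma kernel_distr_measurable:
  "(\<lambda>y. distr (k y) (M \<Otimes>\<^sub>M M) (\<lambda>x. (x, y))) \<in> measurable M (subprob_algebra (M \<Otimes>\<^sub>M M))"
  by (rule measurable_distr2[OF _ k]) measurable

text \<open>The bind takes its sigma-algebra from the kernel at a point of the space, hence the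
  nonemptiness.\<close>

lemma sets_kernel_graph[measurable_cong]: "sets (kernel_graph M k) = sets (M \<Otimes>\<^sub>M M)"
  unfolding kernel_graph_def by (rule sets_bind[OF sets_kernel[OF kernel_distr_measurable] ne])

lemma sets_kernel_eq: "y \<in> space M \<Longrightarrow> sets (k y) = sets M"
  using sets_kernel[OF k] .

lemma subprob_kernel: "y \<in> space M \<Longrightarrow> subprob_space (k y)"
  using measurable_space[OF k] by (simp add: space_subprob_algebra)

lemma measurable_kernelI: "f \<in> measurable M N \<Longrightarrow> y \<in> space M \<Longrightarrow> f \<in> measurable (k y) N"
  using sets_kernel_eq measurable_cong_sets by blast

lemma nn_integral_kernel_graph:
  assumes h[measurable]: "h \<in> borel_measurable (M \<Otimes>\<^sub>M M)"
  shows "(\<integral>\<^sup>+z. h z \<partial>kernel_graph M k) = (\<integral>\<^sup>+y. \<integral>\<^sup>+x. h (x, y) \<partial>k y \<partial>M)"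
proof -
  have "(\<integral>\<^sup>+z. h z \<partial>kernel_graph M k)
      = (\<integral>\<^sup>+y. \<integral>\<^sup>+z. h z \<partial>distr (k y) (M \<Otimes>\<^sub>M M) (\<lambda>x. (x, y)) \<partial>M)"
    unfolding kernel_graph_def by (rule nn_integral_bind[OF h kernel_distr_measurable])
  also have "\<dots> = (\<integral>\<^sup>+y. \<integral>\<^sup>+x. h (x, y) \<partial>k y \<partial>M)"
    by (intro nn_integral_cong nn_integral_distr measurable_kernelI h) measurable
  finally show ?thesis .
qed

text \<open>Split \<open>h\<close> into positive and negative part and use the nonnegative formula
  for each. Both inner integrals are finite almost everywhere, and there their difference is the
  inner Bochner integral.\<close>

lemma integral_kernel_graph:
  fixes h :: "'a \<times> 'a \<Rightarrow> real"
  assumes h: "integrable (kernel_graph M k) h"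
  shows "(\<integral>z. h z \<partial>kernel_graph M k) = (\<integral>y. \<integral>x. h (x, y) \<partial>k y \<partial>M)"
proof -
  have [measurable]: "h \<in> borel_measurable (M \<Otimes>\<^sub>M M)"
    using borel_measurable_integrable[OF h] measurable_cong_sets[OF sets_kernel_graph] by blast
  \<comment> \<open>Since \<open>ennreal\<close> sends negative reals to zero, \<open>I h\<close>
    integrates the positive part of \<open>h\<close> and \<open>I (\<lambda>z. - h z)\<close> the
    negative part.\<close>
  define I where "I g y = (\<integral>\<^sup>+x. ennreal (g (x, y)) \<partial>k y)" for g :: "'a \<times> 'a \<Rightarrow> real" and y
  have Im[measurable]: "I g \<in> borel_measurable M"
    if [measurable]: "g \<in> borel_measurable (M \<Otimes>\<^sub>M M)" for g
    unfolding I_def by (rule nn_integral_measurable_subprob_algebra2[OF _ k]) measurable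
  have fin: "(\<integral>\<^sup>+y. I g y \<partial>M) < \<infinity> \<and> (AE y in M. I g y < \<infinity>) \<and>
      enn2real (\<integral>\<^sup>+z. g z \<partial>kernel_graph M k) = (\<integral>y. enn2real (I g y) \<partial>M) \<and>
      integrable M (\<lambda>y. enn2real (I g y))"
    if g: "g \<in> borel_measurable (M \<Otimes>\<^sub>M M)"
      and fin: "(\<integral>\<^sup>+z. g z \<partial>kernel_graph M k) < \<infinity>" for g
  proof -
    note [measurable] = g
    have eq: "(\<integral>\<^sup>+z. g z \<partial>kernel_graph M k) = (\<integral>\<^sup>+y. I g y \<partial>M)"
      unfolding I_def by (rule nn_integral_kernel_graph) measurable
    then have lt: "(\<integral>\<^sup>+y. I g y \<partial>M) < \<infinity>"
      using fin by simp
    then have ae: "AE y in M. I g y < \<infinity>"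
      using nn_integral_PInf_AE[of "I g" M] Im[OF g] by (auto simp: less_top)
    have eq2: "(\<integral>\<^sup>+y. I g y \<partial>M) = (\<integral>\<^sup>+y. ennreal (enn2real (I g y)) \<partial>M)"
      by (rule nn_integral_cong_AE) (use ae in eventually_elim, auto)
    have int: "integrable M (\<lambda>y. enn2real (I g y))"
      using lt Im[OF g] unfolding eq2 by (intro integrableI_nonneg) auto
    show ?thesis
      using lt ae int unfolding eq
      by (simp add: eq2 integral_eq_nn_integral enn2real_nonneg)
  qed
  have hp: "(\<integral>\<^sup>+z. h z \<partial>kernel_graph M k) < \<infinity>" "(\<integral>\<^sup>+z. ennreal (- h z) \<partial>kernel_graph M k) < \<infinity>"
    using h by (auto simp: real_integrable_def less_top)
  note F = fin[OF _ hp(1)] fin[of "\<lambda>z. - h z", OF _ hp(2)]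
  have "(\<integral>z. h z \<partial>kernel_graph M k) = (\<integral>y. enn2real (I h y) - enn2real (I (\<lambda>z. - h z) y) \<partial>M)"
    using F by (simp add: real_lebesgue_integral_def[OF h])
  also have "\<dots> = (\<integral>y. \<integral>x. h (x, y) \<partial>k y \<partial>M)"
  proof (rule integral_cong_AE)
    have "AE y in M. I h y < \<infinity>" "AE y in M. I (\<lambda>z. - h z) y < \<infinity>"
      using F by auto
    then show "AE y in M. enn2real (I h y) - enn2real (I (\<lambda>z. - h z) y) = (\<integral>x. h (x, y) \<partial>k y)"
      using AE_space
    proof eventually_elim
      case (elim y)
      have "(\<lambda>x. h (x, y)) \<in> borel_measurable (k y)"
        by (rule measurable_kernelI[OF _ elim(3)]) (use elim(3) in measurable)
      then have "integrable (k y) (\<lambda>x. h (x, y))"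
        using elim by (auto simp: real_integrable_def I_def)
      then show ?case
        by (simp add: real_lebesgue_integral_def I_def)
    qed
    \<comment> \<open>Measurability in \<open>y\<close> is obtained on the product space, where the
      integrand \<open>h\<close> no longer depends on \<open>y\<close>.\<close>
    have "(\<lambda>y. \<integral>z. h z \<partial>distr (k y) (M \<Otimes>\<^sub>M M) (\<lambda>x. (x, y))) \<in> borel_measurable M"
      by (rule measurable_compose[OF kernel_distr_measurable integral_measurable_subprob_algebra])
        measurable
    then show "(\<lambda>y. \<integral>x. h (x, y) \<partial>k y) \<in> borel_measurable M"
      by (rule measurable_cong[THEN iffD1, rotated])
        (auto intro!: integral_distr measurable_kernelI)
  qed measurable
  finally show ?thesis .
qed

text \<open>The total mass of each \<open>k y\<close> is at most one, hence an inequality.\<close>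

lemma nn_integral_kernel_graph_snd_le:
  assumes h[measurable]: "h \<in> borel_measurable M"
  shows "(\<integral>\<^sup>+z. h (snd z) \<partial>kernel_graph M k) \<le> (\<integral>\<^sup>+y. h y \<partial>M)"
proof -
  have "(\<integral>\<^sup>+z. h (snd z) \<partial>kernel_graph M k) = (\<integral>\<^sup>+y. \<integral>\<^sup>+x. h y \<partial>k y \<partial>M)"
    by (subst nn_integral_kernel_graph) auto
  also have "\<dots> \<le> (\<integral>\<^sup>+y. h y \<partial>M)"
  proof (rule nn_integral_mono)
    fix y
    assume "y \<in> space M"
    then have "emeasure (k y) (space (k y)) \<le> 1"
      by (rule subprob_space.emeasure_space_le_1[OF subprob_kernel])
    then show "(\<integral>\<^sup>+x. h y \<partial>k y) \<le> h y"
      using mult_left_mono[of "emeasure (k y) (space (k y))" 1 "h y"] by simp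
  qed
  finally show ?thesis .
qed

end

section \<open>The energy of a function in the generator domain\<close>

lemma Lp_1_iff: "f \<in> Lp M 1 \<longleftrightarrow> integrable M f"
  using integrable_abs_iff[of f M] by (auto simp: Lp_def)

lemma Lp_norm_1: "Lp_norm M 1 f = (\<integral>x. \<bar>f x\<bar> \<partial>M)"
  by (simp add: Lp_norm_def)

lemma Linf_bounded: "f \<in> borel_measurable M \<Longrightarrow> (\<And>x. \<bar>f x\<bar> \<le> c) \<Longrightarrow> f \<in> Linf M"
  by (auto simp: Linf_def)

text \<open>Freezes one time and its kernel, so that \<open>p_t(y, dx) dM(y)\<close> becomes the
  single measure \<open>graph\<close> on which the estimates are carried out.\<close>

locale heat_kernel = heat_semigroup M F E P
  for M :: "'a measure" and F E P +
  fixes t :: real and k :: "'a \<Rightarrow> 'a measure"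
  assumes t: "0 < t"
    and kernel: "k \<in> measurable M (subprob_algebra M)"
    and space_nonempty: "space M \<noteq> {}"
    and kernel_rep: "\<And>q f. 1 \<le> q \<Longrightarrow> f \<in> Lp M q \<Longrightarrow> AE y in M. P t f y = (\<integral>x. f x \<partial>k y)"
begin

abbreviation "graph \<equiv> kernel_graph M k"

lemmas kernel_facts = kernel space_nonempty

declare sets_kernel_graph[OF kernel_facts, measurable_cong]

section \<open>Marginals and pairings of the kernel measure\<close>

lemma P_mem: "1 \<le> q \<Longrightarrow> f \<in> Lp M q \<Longrightarrow> P t f \<in> Lp M q"
  using semigroup_mem[OF semigroup_Lp] t by simp

text \<open>
  The truncation is needed because the Bochner integral representing \<open>P\<^sub>t g\<close> is \<open>0\<close> at points
  where \<open>g\<close> is not integrable for the kernel, which has to be excluded first.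
\<close>

lemma nn_integral_graph_fst_le:
  assumes g: "integrable M g" and nonneg: "\<And>x. 0 \<le> g x"
  shows "(\<integral>\<^sup>+z. ennreal (g (fst z)) \<partial>graph) \<le> (\<integral>\<^sup>+x. ennreal (g x) \<partial>M)"
proof -
  have [measurable]: "g \<in> borel_measurable M"
    using g by simp
  define h where "h n x = min (g x) (real n)" for n x
  have hm[measurable]: "h n \<in> borel_measurable M" for n
    unfolding h_def by measurable
  have hb: "0 \<le> h n x" "h n x \<le> g x" "h n x \<le> real n" for n x
    using nonneg by (auto simp: h_def)
  have hL: "h n \<in> Lp M 1" for n
    unfolding Lp_1_iff
    by (rule Bochner_Integration.integrable_bound[OF g]) (use hb nonneg in auto)
  have step: "(\<integral>\<^sup>+z. ennreal (h n (fst z)) \<partial>graph) \<le> (\<integral>\<^sup>+x. ennreal (g x) \<partial>M)" for n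
  proof -
    \<comment> \<open>A bounded function is integrable for a measure of finite mass; this makes the
      Bochner integral in \<open>kernel_rep\<close> agree with the nonnegative one.\<close>
    have int: "integrable (k y) (h n)" if y: "y \<in> space M" for y
    proof -
      interpret subprob_space "k y"
        by (rule subprob_kernel[OF kernel_facts y])
      show ?thesis
        using hb measurable_kernelI[OF kernel_facts hm y]
        by (intro integrable_const_bound[where B = "real n"]) auto
    qed
    have "(\<integral>\<^sup>+z. ennreal (h n (fst z)) \<partial>graph) = (\<integral>\<^sup>+y. \<integral>\<^sup>+x. ennreal (h n x) \<partial>k y \<partial>M)"
      by (subst nn_integral_kernel_graph[OF kernel_facts]) auto
    also have "\<dots> = (\<integral>\<^sup>+y. ennreal (\<integral>x. h n x \<partial>k y) \<partial>M)"
      by (intro nn_integral_cong nn_integral_eq_integral int) (use hb in auto)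
    \<comment> \<open>The representing integral is nonnegative, so the absolute value changes
      nothing; it produces the L^1 norm, which \<open>P t\<close> contracts.\<close>
    also have "\<dots> = (\<integral>\<^sup>+y. ennreal \<bar>P t (h n) y\<bar> \<partial>M)"
    proof (rule nn_integral_cong_AE)
      show "AE y in M. ennreal (\<integral>x. h n x \<partial>k y) = ennreal \<bar>P t (h n) y\<bar>"
        using kernel_rep[OF _ hL[of n]] by (auto simp: hb)
    qed
    also have "\<dots> = ennreal (Lp_norm M 1 (P t (h n)))"
      unfolding Lp_norm_1 using P_mem[OF _ hL[of n]]
      by (intro nn_integral_eq_integral) (auto simp: Lp_1_iff)
    also have "\<dots> \<le> ennreal (Lp_norm M 1 (h n))"
      using semigroup_contraction[OF semigroup_Lp _ hL] t by (intro ennreal_leI) simp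
    also have "\<dots> \<le> ennreal (\<integral>x. g x \<partial>M)"
      unfolding Lp_norm_1 using hL[of n] g hb nonneg
      by (intro ennreal_leI integral_mono) (auto simp: Lp_1_iff)
    also have "\<dots> = (\<integral>\<^sup>+x. ennreal (g x) \<partial>M)"
      using nn_integral_eq_integral[OF g] nonneg by simp
    finally show ?thesis .
  qed
  have sup: "ennreal (g x) = (SUP n. ennreal (h n x))" for x
  proof (rule antisym)
    obtain n where "g x \<le> real n"
      using real_arch_simple by blast
    then have "ennreal (g x) = ennreal (h n x)"
      by (simp add: h_def)
    then show "ennreal (g x) \<le> (SUP n. ennreal (h n x))"
      by (metis SUP_upper UNIV_I)
    show "(SUP n. ennreal (h n x)) \<le> ennreal (g x)"
      by (intro SUP_least ennreal_leI hb)
  qed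
  have "(\<integral>\<^sup>+z. ennreal (g (fst z)) \<partial>graph) = (SUP n. \<integral>\<^sup>+z. ennreal (h n (fst z)) \<partial>graph)"
    unfolding sup
    by (rule nn_integral_monotone_convergence_SUP)
      (auto simp: incseq_def le_fun_def h_def intro!: ennreal_leI)
  also have "\<dots> \<le> (\<integral>\<^sup>+x. ennreal (g x) \<partial>M)"
    by (intro SUP_least step)
  finally show ?thesis .
qed

text \<open>Both marginals of \<open>graph\<close> are dominated by \<open>M\<close>: the first by
  contractivity on L^1, the second by the mass bound on the kernel.\<close>

lemma integral_graph_marginals:
  fixes g :: "'a \<Rightarrow> real"
  assumes g: "integrable M g" and nonneg: "\<And>x. 0 \<le> g x"
  shows "integrable graph (\<lambda>z. g (fst z))" "(\<integral>z. g (fst z) \<partial>graph) \<le> (\<integral>x. g x \<partial>M)"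
    and "integrable graph (\<lambda>z. g (snd z))" "(\<integral>z. g (snd z) \<partial>graph) \<le> (\<integral>x. g x \<partial>M)"
proof -
  have [measurable]: "g \<in> borel_measurable M"
    using g by simp
  have eq: "(\<integral>\<^sup>+x. ennreal (g x) \<partial>M) = ennreal (\<integral>x. g x \<partial>M)"
    using nn_integral_eq_integral[OF g] nonneg by simp
  have *: "integrable graph h \<and> (\<integral>z. h z \<partial>graph) \<le> (\<integral>x. g x \<partial>M)"
    if [measurable]: "h \<in> borel_measurable graph" and h: "\<And>z. 0 \<le> h z"
      and le: "(\<integral>\<^sup>+z. ennreal (h z) \<partial>graph) \<le> (\<integral>\<^sup>+x. ennreal (g x) \<partial>M)" for h
  proof -
    have int: "integrable graph h"
      using le h unfolding eq by (intro integrableI_nonneg) (auto intro: le_less_trans)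
    moreover have "ennreal (\<integral>z. h z \<partial>graph) \<le> ennreal (\<integral>x. g x \<partial>M)"
      using le nn_integral_eq_integral[OF int] h unfolding eq by simp
    ultimately show ?thesis
      using nonneg by (simp add: ennreal_le_iff)
  qed
  show "integrable graph (\<lambda>z. g (fst z))" "(\<integral>z. g (fst z) \<partial>graph) \<le> (\<integral>x. g x \<partial>M)"
    using *[of "\<lambda>z. g (fst z)"] nn_integral_graph_fst_le[OF g] nonneg by auto
  show "integrable graph (\<lambda>z. g (snd z))" "(\<integral>z. g (snd z) \<partial>graph) \<le> (\<integral>x. g x \<partial>M)"
    using *[of "\<lambda>z. g (snd z)"] nonneg
      nn_integral_kernel_graph_snd_le[OF kernel_facts, of "\<lambda>x. ennreal (g x)"] by auto
qed

text \<open>In the iterated integral \<open>v y\<close> is constant for the kernel variable, so the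
  inner integral is the kernel representation of \<open>P t u y\<close> times
  \<open>v y\<close>.\<close>

lemma integral_graph_tensor:
  assumes "1 \<le> q" and u: "u \<in> Lp M q" and v[measurable]: "v \<in> borel_measurable M"
    and int: "integrable graph (\<lambda>z. u (fst z) * v (snd z))"
  shows "(\<integral>z. u (fst z) * v (snd z) \<partial>graph) = (\<integral>y. P t u y * v y \<partial>M)"
proof -
  have [measurable]: "u \<in> borel_measurable M" "P t u \<in> borel_measurable M"
    using Lp_borel u P_mem[OF assms(1) u] by blast+
  have rep: "AE y in M. P t u y * v y = (\<integral>x. u x * v y \<partial>k y)"
    using kernel_rep[OF assms(1) u] by eventually_elim simp
  have "(\<integral>z. u (fst z) * v (snd z) \<partial>graph) = (\<integral>y. \<integral>x. u x * v y \<partial>k y \<partial>M)"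
    using integral_kernel_graph[OF kernel_facts int] by simp
  also have "\<dots> = (\<integral>y. P t u y * v y \<partial>M)"
  proof (rule integral_cong_AE)
    have "(\<lambda>y. \<integral>x. u x \<partial>k y) \<in> borel_measurable M"
      by (rule measurable_compose[OF kernel integral_measurable_subprob_algebra]) measurable
    then show "(\<lambda>y. \<integral>x. u x * v y \<partial>k y) \<in> borel_measurable M"
      by simp
  qed (use rep in auto)
  finally show ?thesis .
qed

section \<open>Symmetry of the cross terms by truncation, and the energy bound\<close>

context
  fixes p :: real and f :: "'a \<Rightarrow> real"
  assumes p: "1 < p" "p \<le> 2" and f: "f \<in> Lp M p"
begin

lemma f_borel[measurable]: "f \<in> borel_measurable M"
  by (rule Lp_borel[OF f])

lemma integrable_graph_dominating:
  "integrable graph (\<lambda>z. \<bar>f (fst z)\<bar> powr p + \<bar>f (snd z)\<bar> powr p)"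
  using integral_graph_marginals[OF Lp_integrable[OF f]] by auto

lemma abs_cross_le:
  "\<bar>a * signed_powr (p - 1) b\<bar> \<le> \<bar>a\<bar> powr p + \<bar>b\<bar> powr p"
  "\<bar>b * signed_powr (p - 1) a\<bar> \<le> \<bar>a\<bar> powr p + \<bar>b\<bar> powr p"
  using mult_powr_le_add[OF p(1), of "\<bar>a\<bar>" "\<bar>b\<bar>"] mult_powr_le_add[OF p(1), of "\<bar>b\<bar>" "\<bar>a\<bar>"]
  by (simp_all add: abs_mult abs_signed_powr)

lemma integrable_cross:
  "integrable graph (\<lambda>z. f (fst z) * signed_powr (p - 1) (f (snd z)))"
  "integrable graph (\<lambda>z. f (snd z) * signed_powr (p - 1) (f (fst z)))"
  by (auto intro!: Bochner_Integration.integrable_bound[OF integrable_graph_dominating] abs_cross_le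
      simp flip: abs_mult)

text \<open>Both cuts matter: discarding small values leaves a set of finite measure, so that powers
  of \<open>f\<close> become integrable, and discarding large values gives boundedness. The duality
  of L^1 and L-infinity then applies.\<close>

definition trunc :: "nat \<Rightarrow> 'a \<Rightarrow> real" where
  "trunc n x = (if inverse (real (Suc n)) \<le> \<bar>f x\<bar> \<and> \<bar>f x\<bar> \<le> real (Suc n) then f x else 0)"

lemma trunc_borel[measurable]: "trunc n \<in> borel_measurable M"
  unfolding trunc_def by measurable

lemma abs_trunc_le: "\<bar>trunc n x\<bar> \<le> \<bar>f x\<bar>"
  by (simp add: trunc_def)

lemma trunc_tendsto: "(\<lambda>n. trunc n x) \<longlonglongrightarrow> f x"
proof (cases "f x = 0")
  case False
  have "\<forall>\<^sub>F n in sequentially. inverse (real (Suc n)) < \<bar>f x\<bar>"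
    using order_tendstoD(2)[OF LIMSEQ_inverse_real_of_nat, of "\<bar>f x\<bar>"] False by simp
  moreover have "\<forall>\<^sub>F n in sequentially. \<bar>f x\<bar> \<le> real n"
    using eventually_ge_at_top[of "nat \<lceil>\<bar>f x\<bar>\<rceil>"] by eventually_elim linarith
  ultimately have "\<forall>\<^sub>F n in sequentially. trunc n x = f x"
    by eventually_elim (simp add: trunc_def)
  then show ?thesis
    by (rule tendsto_eventually)
qed (simp add: trunc_def)

text \<open>Where \<open>trunc n\<close> is nonzero, \<open>1 \<le> r * \<bar>f x\<bar>\<close> with
  \<open>r = Suc n\<close>; multiplying by powers of this quantity raises the exponents
  \<open>1\<close> and \<open>p - 1\<close> to \<open>p\<close>, whose power of \<open>f\<close> is
  integrable.\<close>

lemma trunc_Lp_1: "trunc n \<in> Lp M 1" "(\<lambda>x. signed_powr (p - 1) (trunc n x)) \<in> Lp M 1"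
proof -
  define r where "r = real (Suc n)"
  have r: "1 \<le> r"
    by (simp add: r_def)
  have *: "\<bar>trunc n x\<bar> \<le> r powr (p - 1) * \<bar>f x\<bar> powr p"
    "\<bar>signed_powr (p - 1) (trunc n x)\<bar> \<le> r * \<bar>f x\<bar> powr p" for x
  proof (atomize(full), cases "inverse r \<le> \<bar>f x\<bar>")
    case True
    have pos: "0 < \<bar>f x\<bar>"
      using True r by (smt (verit) inverse_positive_iff_positive)
    then have ge1: "1 \<le> r * \<bar>f x\<bar>"
      using True r by (simp add: field_simps)
    have "1 \<le> (r * \<bar>f x\<bar>) powr (p - 1)"
      using ge1 p by (intro ge_one_powr_ge_zero) auto
    then have "\<bar>f x\<bar> * 1 \<le> \<bar>f x\<bar> * (r powr (p - 1) * \<bar>f x\<bar> powr (p - 1))"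
      using r by (intro mult_left_mono) (auto simp: powr_mult)
    moreover have "\<bar>f x\<bar> powr (p - 1) * 1 \<le> \<bar>f x\<bar> powr (p - 1) * (r * \<bar>f x\<bar>)"
      using ge1 by (intro mult_left_mono) auto
    moreover have "\<bar>f x\<bar> powr p = \<bar>f x\<bar> * \<bar>f x\<bar> powr (p - 1)"
      using pos by (simp add: powr_diff)
    moreover have "\<bar>trunc n x\<bar> powr (p - 1) \<le> \<bar>f x\<bar> powr (p - 1)"
      using abs_trunc_le[of n x] p by (intro powr_mono2) auto
    ultimately show "\<bar>trunc n x\<bar> \<le> r powr (p - 1) * \<bar>f x\<bar> powr p \<and>
        \<bar>signed_powr (p - 1) (trunc n x)\<bar> \<le> r * \<bar>f x\<bar> powr p"
      using abs_trunc_le[of n x] by (simp add: abs_signed_powr mult_ac)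
  next
    case False
    then have "trunc n x = 0"
      by (simp add: trunc_def r_def)
    then show "\<bar>trunc n x\<bar> \<le> r powr (p - 1) * \<bar>f x\<bar> powr p \<and>
        \<bar>signed_powr (p - 1) (trunc n x)\<bar> \<le> r * \<bar>f x\<bar> powr p"
      using r by (simp add: signed_powr_def)
  qed
  have int: "integrable M (\<lambda>x. c * \<bar>f x\<bar> powr p)" for c
    using Lp_integrable[OF f] by simp
  show "trunc n \<in> Lp M 1"
    unfolding Lp_1_iff
    by (rule Bochner_Integration.integrable_bound[OF int[of "r powr (p - 1)"]]) (use * r in auto)
  show "(\<lambda>x. signed_powr (p - 1) (trunc n x)) \<in> Lp M 1"
    unfolding Lp_1_iff
    by (rule Bochner_Integration.integrable_bound[OF int[of r]]) (use * r in auto)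
qed

lemma trunc_Linf: "(\<lambda>x. signed_powr (p - 1) (trunc n x)) \<in> Linf M"
proof (rule Linf_bounded)
  show "\<bar>signed_powr (p - 1) (trunc n x)\<bar> \<le> real (Suc n) powr (p - 1)" for x
    unfolding abs_signed_powr using p by (intro powr_mono2) (auto simp: trunc_def)
qed measurable

lemma abs_cross_trunc_le:
  "\<bar>trunc n x * signed_powr (p - 1) (trunc n y)\<bar> \<le> \<bar>f x\<bar> powr p + \<bar>f y\<bar> powr p"
  "\<bar>trunc n y * signed_powr (p - 1) (trunc n x)\<bar> \<le> \<bar>f x\<bar> powr p + \<bar>f y\<bar> powr p"
proof -
  have "\<bar>trunc n x\<bar> powr p + \<bar>trunc n y\<bar> powr p \<le> \<bar>f x\<bar> powr p + \<bar>f y\<bar> powr p"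
    using p by (intro add_mono powr_mono2 abs_trunc_le) auto
  then show "\<bar>trunc n x * signed_powr (p - 1) (trunc n y)\<bar> \<le> \<bar>f x\<bar> powr p + \<bar>f y\<bar> powr p"
    "\<bar>trunc n y * signed_powr (p - 1) (trunc n x)\<bar> \<le> \<bar>f x\<bar> powr p + \<bar>f y\<bar> powr p"
    using abs_cross_le[where a = "trunc n x" and b = "trunc n y"] by simp_all
qed

text \<open>This is the duality of L^1 and L-infinity, with the signed power as the bounded factor;
  \<open>integral_graph_tensor\<close> translates both pairings to \<open>graph\<close>. The signed
  power lies in L^1 as well, which gives \<open>P t\<close> of it a kernel representation.\<close>

lemma integral_cross_trunc_symmetric:
  "(\<integral>z. trunc n (fst z) * signed_powr (p - 1) (trunc n (snd z)) \<partial>graph)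
    = (\<integral>z. trunc n (snd z) * signed_powr (p - 1) (trunc n (fst z)) \<partial>graph)"
proof -
  let ?u = "trunc n" and ?v = "\<lambda>x. signed_powr (p - 1) (trunc n x)"
  have int: "integrable graph (\<lambda>z. ?u (fst z) * ?v (snd z))"
    "integrable graph (\<lambda>z. ?v (fst z) * ?u (snd z))"
    unfolding mult.commute[of "?v _"]
    by (auto intro!: Bochner_Integration.integrable_bound[OF integrable_graph_dominating]
        abs_cross_trunc_le simp flip: abs_mult)
  have "(\<integral>z. ?u (fst z) * ?v (snd z) \<partial>graph) = (\<integral>y. P t ?u y * ?v y \<partial>M)"
    by (rule integral_graph_tensor[OF _ trunc_Lp_1(1) _ int(1)]) auto
  also have "\<dots> = (\<integral>y. ?u y * P t ?v y \<partial>M)"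
    by (rule duality_L1_Linf) (use t trunc_Lp_1 trunc_Linf in auto)
  also have "\<dots> = (\<integral>z. ?v (fst z) * ?u (snd z) \<partial>graph)"
    by (subst integral_graph_tensor[OF _ trunc_Lp_1(2) _ int(2)]) (auto simp: mult.commute)
  finally show ?thesis
    by (simp add: mult.commute)
qed

text \<open>Dominated convergence from the truncated identity, with one majorant
  \<open>\<bar>f x\<bar> powr p + \<bar>f y\<bar> powr p\<close> for both sides.\<close>

lemma integral_cross_symmetric:
  "(\<integral>z. f (fst z) * signed_powr (p - 1) (f (snd z)) \<partial>graph)
    = (\<integral>z. f (snd z) * signed_powr (p - 1) (f (fst z)) \<partial>graph)"
proof (rule LIMSEQ_unique)
  have cont: "(\<lambda>n. signed_powr (p - 1) (trunc n x)) \<longlonglongrightarrow> signed_powr (p - 1) (f x)" for x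
  \<comment> \<open>The factor \<open>sgn\<close> is discontinuous at zero, but where
    \<open>f\<close> vanishes so do all truncations.\<close>
  proof (cases "f x = 0")
    case False
    then show ?thesis
      unfolding signed_powr_def by (intro tendsto_intros trunc_tendsto) auto
  qed (simp add: trunc_def)
  show "(\<lambda>n. \<integral>z. trunc n (fst z) * signed_powr (p - 1) (trunc n (snd z)) \<partial>graph)
      \<longlonglongrightarrow> (\<integral>z. f (fst z) * signed_powr (p - 1) (f (snd z)) \<partial>graph)"
    by (rule integral_dominated_convergence[OF _ _ integrable_graph_dominating])
      (auto intro!: tendsto_mult cont trunc_tendsto abs_cross_trunc_le simp flip: abs_mult)
  have "(\<lambda>n. \<integral>z. trunc n (snd z) * signed_powr (p - 1) (trunc n (fst z)) \<partial>graph)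
      \<longlonglongrightarrow> (\<integral>z. f (snd z) * signed_powr (p - 1) (f (fst z)) \<partial>graph)"
    by (rule integral_dominated_convergence[OF _ _ integrable_graph_dominating])
      (auto intro!: tendsto_mult cont trunc_tendsto abs_cross_trunc_le simp flip: abs_mult)
  then show "(\<lambda>n. \<integral>z. trunc n (fst z) * signed_powr (p - 1) (trunc n (snd z)) \<partial>graph)
      \<longlonglongrightarrow> (\<integral>z. f (snd z) * signed_powr (p - 1) (f (fst z)) \<partial>graph)"
    by (simp only: integral_cross_trunc_symmetric)
qed

text \<open>Expanding \<open>A\<close> gives two diagonal terms, bounded through the marginals by
  the integral of \<open>\<bar>f\<bar> powr p\<close>, and two cross terms, which symmetry merges
  into twice the pairing of \<open>P t f\<close> with \<phi>(f). Since
  \<open>\<bar>f\<bar> powr p\<close> is \<open>f\<close> times \<phi>(f), what remains is twice the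
  pairing of \<open>f - P t f\<close> with \<phi>(f), to which Hoelder applies.\<close>

lemma signed_energy_le:
  defines "A \<equiv> \<lambda>z. (f (fst z) - f (snd z)) *
    (signed_powr (p - 1) (f (fst z)) - signed_powr (p - 1) (f (snd z)))"
  shows "integrable graph A"
    and "(\<integral>z. A z \<partial>graph)
      \<le> 2 * (Lp_norm M p (\<lambda>x. P t f x - f x) * Lp_norm M p f powr (p - 1))"
proof -
  have p1: "1 \<le> p"
    using p by simp
  note marg = integral_graph_marginals[OF Lp_integrable[OF f]]
  note [measurable] = P_mem[OF p1 f, THEN Lp_borel]
  have A: "A = (\<lambda>z. \<bar>f (fst z)\<bar> powr p + \<bar>f (snd z)\<bar> powr p -
      f (fst z) * signed_powr (p - 1) (f (snd z)) - f (snd z) * signed_powr (p - 1) (f (fst z)))"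
    by (auto simp: A_def algebra_simps simp flip: mult_signed_powr)
  show "integrable graph A"
    unfolding A using marg integrable_cross by auto
  have hold: "integrable M (\<lambda>x. u x * signed_powr (p - 1) (f x))" if u: "u \<in> Lp M p" for u
  proof -
    note [measurable] = Lp_borel[OF u]
    show ?thesis
      using Lp_integrable[OF u] Lp_integrable[OF f] abs_cross_le
      by (intro Bochner_Integration.integrable_bound[OF Bochner_Integration.integrable_add
            [OF Lp_integrable[OF u] Lp_integrable[OF f]]]) auto
  qed
  have d: "(\<lambda>x. P t f x - f x) \<in> Lp M p"
    by (rule Lp_diff[OF p1 P_mem[OF p1 f] f])
  have "(\<integral>z. A z \<partial>graph) = (\<integral>z. \<bar>f (fst z)\<bar> powr p \<partial>graph) + (\<integral>z. \<bar>f (snd z)\<bar> powr p \<partial>graph)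
      - 2 * (\<integral>z. f (fst z) * signed_powr (p - 1) (f (snd z)) \<partial>graph)"
    unfolding A using marg integrable_cross integral_cross_symmetric by simp
  also have "\<dots> \<le> 2 * (\<integral>x. \<bar>f x\<bar> powr p \<partial>M)
      - 2 * (\<integral>x. P t f x * signed_powr (p - 1) (f x) \<partial>M)"
    using marg integral_graph_tensor[OF p1 f _ integrable_cross(1)] by simp
  also have "\<dots> = 2 * ((\<integral>x. f x * signed_powr (p - 1) (f x) \<partial>M)
      - (\<integral>x. P t f x * signed_powr (p - 1) (f x) \<partial>M))"
    by (simp add: mult_signed_powr)
  also have "\<dots> = 2 * (\<integral>x. - ((P t f x - f x) * signed_powr (p - 1) (f x)) \<partial>M)"
    using hold[OF f] hold[OF P_mem[OF p1 f]]
    by (subst Bochner_Integration.integral_diff[symmetric]) (auto simp: algebra_simps)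
  also have "(\<integral>x. - ((P t f x - f x) * signed_powr (p - 1) (f x)) \<partial>M)
      \<le> (\<integral>x. \<bar>(P t f x - f x) * signed_powr (p - 1) (f x)\<bar> \<partial>M)"
    using hold[OF d] by (intro integral_mono) auto
  also have "\<dots> = (\<integral>x. \<bar>P t f x - f x\<bar> * \<bar>f x\<bar> powr (p - 1) \<partial>M)"
    by (simp add: abs_mult abs_signed_powr)
  also have "\<dots> \<le> Lp_norm M p (\<lambda>x. P t f x - f x) * Lp_norm M p f powr (p - 1)"
    by (rule Hoelder_Lp_norm[OF p(1) f d])
  finally show "(\<integral>z. A z \<partial>graph)
      \<le> 2 * (Lp_norm M p (\<lambda>x. P t f x - f x) * Lp_norm M p f powr (p - 1))"
    by simp
qed

end

end

text \<open>The choice \<open>s = T / N\<close> makes both terms multiples of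
  \<open>(T * N) powr (p / 2)\<close>. If \<open>N = 0\<close> any \<open>s\<close> serves, and if
  \<open>T = 0\<close> the bound follows as \<open>s\<close> tends to zero.\<close>

lemma interpolation_bound_optimize:
  fixes p c T N I :: real
  assumes p: "1 < p" "p \<le> 2" and c: "0 \<le> c" and T: "0 \<le> T" and N: "0 \<le> N"
    and le: "\<And>s. 0 < s \<Longrightarrow>
      I \<le> c * s powr (p / 2 - 1) * (2 * (T * N powr (p - 1))) + s powr (p / 2) * (2 * N powr p)"
  shows "I \<le> (2 * c + 2) * (T * N) powr (p / 2)"
proof -
  consider "N = 0" | "T = 0" | "0 < N" "0 < T"
    using T N by linarith
  then show ?thesis
  proof cases
    case 1
    then show ?thesis
      using le[of 1] by simp
  next
    case 2
    have "((\<lambda>s. s powr (p / 2) * (2 * N powr p)) \<longlongrightarrow> 0 powr (p / 2) * (2 * N powr p)) (at_right 0)"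
      using p by (intro tendsto_mult tendsto_const tendsto_powr')
        (auto intro!: eventually_mono[OF eventually_at_right_less[of 0]])
    moreover have "\<forall>\<^sub>F s in at_right 0. I \<le> s powr (p / 2) * (2 * N powr p)"
      using eventually_at_right_less[of 0] by eventually_elim (use le 2 in auto)
    ultimately have "I \<le> 0 powr (p / 2) * (2 * N powr p)"
      by (intro tendsto_lowerbound) auto
    then show ?thesis
      using 2 by simp
  next
    case 3
    have Np: "N powr p = N powr (p / 2) * N powr (p / 2)"
      by (simp flip: powr_add)
    have "(T / N) powr (p / 2 - 1) * (T * N powr (p - 1))
        = T powr (p / 2 - 1 + 1) * N powr (p - 1 - (p / 2 - 1))"
      using 3 by (simp add: powr_divide powr_add powr_diff Np)
    also have "\<dots> = (T * N) powr (p / 2)"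
      using 3 by (simp add: powr_mult)
    finally have 1: "(T / N) powr (p / 2 - 1) * (T * N powr (p - 1)) = (T * N) powr (p / 2)" .
    have 2: "(T / N) powr (p / 2) * N powr p = (T * N) powr (p / 2)"
      using 3 by (simp add: powr_divide powr_mult Np)
    have "I \<le> 2 * c * ((T / N) powr (p / 2 - 1) * (T * N powr (p - 1)))
        + 2 * ((T / N) powr (p / 2) * N powr p)"
      using le[of "T / N"] 3 by (simp add: algebra_simps)
    then show ?thesis
      unfolding 1 2 by (simp add: algebra_simps)
  qed
qed

section \<open>Energy bound at a fixed time\<close>

lemma (in heat_kernel) besov_energy_le:
  assumes p: "1 < p" "p \<le> 2" and gen: "is_Lp_generator M P p f g"
  shows "(\<integral>\<^sup>+y. \<integral>\<^sup>+x. ennreal (\<bar>f x - f y\<bar> powr p) \<partial>k y \<partial>M)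
    \<le> ennreal ((4 / (p - 1) + 2) * (t * Lp_norm M p g * Lp_norm M p f) powr (p / 2))"
proof -
  have p1: "1 \<le> p"
    using p by simp
  have f: "f \<in> Lp M p"
    using gen by (simp add: is_Lp_generator_def)
  have [measurable]: "f \<in> borel_measurable M"
    by (rule Lp_borel[OF f])
  note marg = integral_graph_marginals[OF Lp_integrable[OF f]]
  note energy = signed_energy_le[OF p f]
  define A where "A z = (f (fst z) - f (snd z)) *
    (signed_powr (p - 1) (f (fst z)) - signed_powr (p - 1) (f (snd z)))" for z
  define W where "W z = \<bar>f (fst z)\<bar> powr p + \<bar>f (snd z)\<bar> powr p" for z
  define N where "N = Lp_norm M p f"
  define T where "T = t * Lp_norm M p g"
  have A: "integrable graph A" "(\<integral>z. A z \<partial>graph) \<le> 2 * (T * N powr (p - 1))"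
  proof -
    show "integrable graph A"
      using energy(1) by (simp add: A_def[abs_def])
    \<comment> \<open>The generator enters here: the increment over time \<open>t\<close> has norm
      at most \<open>T\<close>.\<close>
    have "Lp_norm M p (\<lambda>x. P t f x - f x) * N powr (p - 1) \<le> T * N powr (p - 1)"
      unfolding T_def
      by (intro mult_right_mono generator_increment_le[OF p1 semigroup_Lp[OF p1] gen t]) simp
    then show "(\<integral>z. A z \<partial>graph) \<le> 2 * (T * N powr (p - 1))"
      using energy(2) by (simp add: A_def[abs_def] N_def)
  qed
  have W: "integrable graph W" "(\<integral>z. W z \<partial>graph) \<le> 2 * N powr p"
    using marg p by (auto simp: W_def[abs_def] N_def Lp_norm_powr)
  have le: "\<bar>f (fst z) - f (snd z)\<bar> powr p
      \<le> 2 / (p - 1) * s powr (p / 2 - 1) * A z + s powr (p / 2) * W z" if "0 < s" for s z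
    unfolding A_def W_def by (rule abs_diff_powr_le[OF p that])
  \<comment> \<open>The pointwise bound at \<open>s = 1\<close> already provides an integrable
    majorant.\<close>
  have int: "integrable graph (\<lambda>z. \<bar>f (fst z) - f (snd z)\<bar> powr p)"
  proof (rule Bochner_Integration.integrable_bound)
    show "integrable graph (\<lambda>z. 2 / (p - 1) * 1 powr (p / 2 - 1) * A z + 1 powr (p / 2) * W z)"
      using A(1) W(1) by auto
    show "AE z in graph. norm (\<bar>f (fst z) - f (snd z)\<bar> powr p)
        \<le> norm (2 / (p - 1) * 1 powr (p / 2 - 1) * A z + 1 powr (p / 2) * W z)"
      using order_trans[OF le[OF zero_less_one] abs_ge_self] by simp
  qed measurable
  \<comment> \<open>The parameter \<open>c\<close> of the optimization is
    \<open>2 / (p - 1)\<close>, the constant of \<open>abs_diff_powr_le\<close>.\<close>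
  have "(\<integral>z. \<bar>f (fst z) - f (snd z)\<bar> powr p \<partial>graph) \<le> (2 * (2 / (p - 1)) + 2) * (T * N) powr (p / 2)"
  proof (rule interpolation_bound_optimize[OF p])
    fix s :: real
    assume s: "0 < s"
    have "(\<integral>z. \<bar>f (fst z) - f (snd z)\<bar> powr p \<partial>graph)
        \<le> (\<integral>z. 2 / (p - 1) * s powr (p / 2 - 1) * A z + s powr (p / 2) * W z \<partial>graph)"
      using A(1) W(1) int le[OF s] by (intro integral_mono) auto
    also have "\<dots> = 2 / (p - 1) * s powr (p / 2 - 1) * (\<integral>z. A z \<partial>graph)
        + s powr (p / 2) * (\<integral>z. W z \<partial>graph)"
      using A(1) W(1) by simp
    also have "\<dots> \<le> 2 / (p - 1) * s powr (p / 2 - 1) * (2 * (T * N powr (p - 1)))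
        + s powr (p / 2) * (2 * N powr p)"
      using p by (intro add_mono mult_left_mono A(2) W(2)) auto
    finally show "(\<integral>z. \<bar>f (fst z) - f (snd z)\<bar> powr p \<partial>graph)
        \<le> 2 / (p - 1) * s powr (p / 2 - 1) * (2 * (T * N powr (p - 1)))
          + s powr (p / 2) * (2 * N powr p)" .
  qed (use p t in \<open>auto simp: T_def N_def Lp_norm_nonneg\<close>)
  then have "ennreal (\<integral>z. \<bar>f (fst z) - f (snd z)\<bar> powr p \<partial>graph)
      \<le> ennreal ((4 / (p - 1) + 2) * (T * N) powr (p / 2))"
    by (intro ennreal_leI) simp
  moreover have "(\<integral>\<^sup>+y. \<integral>\<^sup>+x. ennreal (\<bar>f x - f y\<bar> powr p) \<partial>k y \<partial>M)
      = ennreal (\<integral>z. \<bar>f (fst z) - f (snd z)\<bar> powr p \<partial>graph)"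
    using nn_integral_kernel_graph[OF kernel_facts,
        of "\<lambda>z. ennreal (\<bar>f (fst z) - f (snd z)\<bar> powr p)"]
      nn_integral_eq_integral[OF int] by simp
  ultimately show ?thesis
    by (simp add: T_def N_def)
qed

section \<open>Passage to the Besov seminorm\<close>

lemma ennreal_powr_le:
  assumes "a \<le> ennreal b" "0 \<le> b" "0 \<le> r"
  shows "ennreal_powr a r \<le> ennreal (b powr r)"
proof (cases a)
  case (real x)
  then show ?thesis
    using assms by (auto simp: ennreal_powr_def intro!: ennreal_leI powr_mono2)
qed (use assms in \<open>auto simp: top_unique\<close>)

theorem proposition0p2:
  fixes p :: real
  assumes "1 < p" and "p \<le> 2"
  shows "\<exists>C>0. \<forall>(M :: 'a::topological_space measure) F E P \<kappa>.
           radon_measure M \<longrightarrow> heat_semigroup M F E P \<longrightarrow> conservative M P \<longrightarrow>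
           heat_kernel_measures M P \<kappa> \<longrightarrow>
             Lp_domain M P p \<subseteq> besov_space M \<kappa> p (1 / 2) \<and>
             (\<forall>f\<in>Lp_domain M P p.
                (besov_seminorm M \<kappa> p (1 / 2) f)\<^sup>2
                  \<le> ennreal (C * Lp_norm M p (Lp_generator M P p f) * Lp_norm M p f))"
proof -
  \<comment> \<open>The constant of \<open>besov_energy_le\<close>; taking the root of order
    \<open>p\<close> and then squaring turns it into \<open>K powr (2 / p)\<close>.\<close>
  define K where "K = 4 / (p - 1) + 2"
  have K: "0 < K"
    using assms by (simp add: K_def add_pos_pos)
  have bound: "f \<in> besov_space M \<kappa> p (1 / 2) \<and> (besov_seminorm M \<kappa> p (1 / 2) f)\<^sup>2
      \<le> ennreal (K powr (2 / p) * Lp_norm M p (Lp_generator M P p f) * Lp_norm M p f)"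
    if rad: "radon_measure M" and heat: "heat_semigroup M F E P"
      and ker: "heat_kernel_measures M P \<kappa>" and dom: "f \<in> Lp_domain M P p"
    for M :: "'a measure" and F E P \<kappa> f
  proof -
    define g where "g = Lp_generator M P p f"
    have gen: "is_Lp_generator M P p f g"
      using dom someI_ex[of "is_Lp_generator M P p f"]
      by (simp add: g_def Lp_generator_def Lp_domain_def)
    \<comment> \<open>A Radon measure has the whole type as its space, and types are
      inhabited.\<close>
    have ne: "space M \<noteq> {}"
      using rad sets_eq_imp_space_eq[of M borel] by (auto simp: radon_measure_def)
    define D where "D = Lp_norm M p g * Lp_norm M p f"
    have D: "0 \<le> D"
      by (simp add: D_def Lp_norm_nonneg)
    have "besov_seminorm M \<kappa> p (1 / 2) f \<le> ennreal (K powr (1 / p) * D powr (1 / 2))"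
      unfolding besov_seminorm_def
    proof (rule SUP_least)
      fix t :: real
      assume "t \<in> {0<..}"
      then have t: "0 < t"
        by simp
      interpret heat_semigroup M F E P
        by (rule heat)
      interpret heat_kernel M F E P t "\<kappa> t"
      proof
        show "AE y in M. P t u y = (\<integral>x. u x \<partial>\<kappa> t y)" if "1 \<le> q" "u \<in> Lp M q" for q u
          using ker t that unfolding heat_kernel_measures_def by blast
      qed (use ker t ne in \<open>auto simp: heat_kernel_measures_def\<close>)
      let ?I = "\<integral>\<^sup>+y. \<integral>\<^sup>+x. ennreal (\<bar>f x - f y\<bar> powr p) \<partial>\<kappa> t y \<partial>M"
      have "?I \<le> ennreal (K * (t * D) powr (p / 2))"
        using besov_energy_le[OF assms gen] by (simp add: K_def D_def mult.assoc)
      then have "ennreal_powr ?I (1 / p) \<le> ennreal ((K * (t * D) powr (p / 2)) powr (1 / p))"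
        using K assms by (intro ennreal_powr_le) auto
      then have "ennreal (t powr - (1 / 2)) * ennreal_powr ?I (1 / p)
          \<le> ennreal (t powr - (1 / 2)) * ennreal ((K * (t * D) powr (p / 2)) powr (1 / p))"
        by (rule mult_left_mono) simp
      also have "\<dots> = ennreal (t powr - (1 / 2) * (K * (t * D) powr (p / 2)) powr (1 / p))"
        by (simp add: ennreal_mult)
      \<comment> \<open>The factor \<open>t powr (1 / 2)\<close> from the energy bound cancels the
        weight, so the bound is uniform in \<open>t\<close>.\<close>
      also have "t powr - (1 / 2) * (K * (t * D) powr (p / 2)) powr (1 / p)
          = K powr (1 / p) * D powr (1 / 2)"
        using K D t assms by (simp add: powr_mult powr_powr powr_minus)
      finally show "ennreal (t powr - (1 / 2)) * ennreal_powr ?I (1 / p)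
          \<le> ennreal (K powr (1 / p) * D powr (1 / 2))" .
    qed
    moreover from this have "(besov_seminorm M \<kappa> p (1 / 2) f)\<^sup>2
        \<le> (ennreal (K powr (1 / p) * D powr (1 / 2)))\<^sup>2"
      by (rule power_mono) simp
    moreover have "(ennreal (K powr (1 / p) * D powr (1 / 2)))\<^sup>2 = ennreal (K powr (2 / p) * D)"
    proof -
      have "(K powr (1 / p))\<^sup>2 = K powr (2 / p)" "(D powr (1 / 2))\<^sup>2 = D"
        using K D by (simp_all add: power2_eq_square flip: powr_add)
      then show ?thesis
        by (simp add: ennreal_power power_mult_distrib)
    qed
    ultimately show ?thesis
      using gen by (auto simp: besov_space_def is_Lp_generator_def D_def g_def mult.assoc
          intro: le_less_trans)
  qed
  show ?thesis
    using K bound by (intro exI[of _ "K powr (2 / p)"]) (auto; blast)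
qed

end
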